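(* Let $\alpha,\beta,\gamma\in\mathbb{R}$ with $\gamma\neq 0$, and let $(G_2,g,J)$ be the connected three-dimensional unimodular Lie group with left-invariant Lorentzian metric $g$ whose Lie algebra has a pseudo-orthonormal basis $\{e_1,e_2,e_3\}$, $e_3$ timelike, with $$[e_1,e_2]=\gamma e_2-\beta e_3,\quad [e_1,e_3]=-\beta e_2-\gamma e_3,\quad [e_2,e_3]=\alpha e_1,$$ and with the product structure $J$ given by $Je_1=e_1$, $Je_2=e_2$, $Je_3=-e_3$. Then $(G_2,g,J)$ admits left-invariant Ricci collineations associated to the Kobayashi-Nomizu connection $\nabla^1$ if and only if one of the following holds, and in each case the space $\mathbb{V}_{\mathbb{RC}}$ of these collineations is as indicated: (1) $\alpha=\beta=0$, with $\mathbb{V}_{\mathbb{RC}}=\langle e_3\rangle$ (i.e. $\lambda_1=\lambda_2=0$); (2) $\alpha=0$, $\beta\neq0$, with $\mathbb{V}_{\mathbb{RC}}=\langle e_2+\frac{\gamma}{\beta}e_3\rangle$ (in particular $\lambda_1=0$); (3) $\alpha\neq0$, $\beta\neq0$, $\alpha=4\beta$, with $\mathbb{V}_{\mathbb{RC}}=\langle e_2-\frac{2\beta^2+\gamma^2}{\beta\gamma}e_3\rangle$ (i.e. $\lambda_1=0$, $\lambda_3=-\frac{2\beta^2+\gamma^2}{\beta\gamma}\lambda_2$).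
   Context: Pseudo-orthonormal with $e_3$ timelike means $g(e_1,e_1)=g(e_2,e_2)=1$, $g(e_3,e_3)=-1$, $g(e_i,e_j)=0$ for $i\ne j$. $J$ is extended left-invariantly to a $(1,1)$-tensor with $J^2=\mathrm{id}$. Let $\nabla$ be the Levi-Civita connection of $g$. The canonical connection is $\nabla^0_XY=\nabla_XY-\frac12(\nabla_XJ)JY$, and the Kobayashi-Nomizu connection is $$\nabla^1_XY=\nabla^0_XY-\tfrac14\big[(\nabla_YJ)JX-(\nabla_{JY}J)X\big],$$ with curvature $R^1(X,Y)Z=\nabla^1_X\nabla^1_YZ-\nabla^1_Y\nabla^1_XZ-\nabla^1_{[X,Y]}Z$. Its Ricci tensor is $$\mathrm{Ric}^1(X,Y)=-g(R^1(X,e_1)Y,e_1)-g(R^1(X,e_2)Y,e_2)+g(R^1(X,e_3)Y,e_3),$$ and its symmetrization is $\widetilde{\mathrm{Ric}}^1(X,Y)=\frac12\big(\mathrm{Ric}^1(X,Y)+\mathrm{Ric}^1(Y,X)\big)$. For a left-invariant vector field $\xi=\lambda_1e_1+\lambda_2e_2+\lambda_3e_3$ ($\lambda_i\in\mathbb{R}$), $$(L_\xi\widetilde{\mathrm{Ric}}^1)(X,Y)=\xi\big(\widetilde{\mathrm{Ric}}^1(X,Y)\big)-\widetilde{\mathrm{Ric}}^1([\xi,X],Y)-\widetilde{\mathrm{Ric}}^1(X,[\xi,Y]).$$ A left-invariant Ricci collineation associated to $\nabla^1$ is a left-invariant $\xi$ with $L_\xi\widetilde{\mathrm{Ric}}^1=0$;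 $\mathbb{V}_{\mathbb{RC}}$ denotes the real vector space of all of them, and $\langle\cdot\rangle$ denotes linear span. The group admits left-invariant Ricci collineations if there is a nonzero such $\xi$. *)

theory Defs
  imports "HOL-Analysis.Analysis" "HOL-Library.Function_Algebras"
begin

text \<open>
  Tangent vectors are point derivations of the algebra of smooth functions and vector fields are
  sections of them, so both live in function spaces; this instance gives them the library's
  pointwise real vector space structure (hence \<open>span\<close> and \<open>independent\<close>).
\<close>

instantiation "fun" :: (type, real_vector) real_vector
begin

definition scaleR_fun :: "real \<Rightarrow> ('a \<Rightarrow> 'b) \<Rightarrow> 'a \<Rightarrow> 'b"
  where "scaleR_fun c f = (\<lambda>x. c *\<^sub>R f x)"

instance
  by standard (auto simp: scaleR_fun_def fun_eq_iff scaleR_add_right scaleR_add_left)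

end

text \<open>\<open>Ck_on k S f\<close> is only meant for open \<open>S\<close>.\<close>

primrec Ck_on :: "nat \<Rightarrow> 'a::real_normed_vector set \<Rightarrow> ('a \<Rightarrow> 'b::real_normed_vector) \<Rightarrow> bool"
  where
    "Ck_on 0 S f \<longleftrightarrow> continuous_on S f"
  | "Ck_on (Suc k) S f \<longleftrightarrow>
       f differentiable_on S \<and> (\<forall>v. Ck_on k S (\<lambda>x. frechet_derivative f (at x) v))"

definition smooth_on :: "'a::real_normed_vector set \<Rightarrow> ('a \<Rightarrow> 'b::real_normed_vector) \<Rightarrow> bool"
  where "smooth_on S f \<longleftrightarrow> (\<forall>k. Ck_on k S f)"

text \<open>A chart is a pair of an open set \<open>U\<close> and a map \<open>\<phi>\<close>, of which only the values on \<open>U\<close> matter.\<close>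

type_synonym ('m, 'e) chart = "'m set \<times> ('m \<Rightarrow> 'e)"

definition smooth_atlas ::
    "('m::topological_space, 'e::euclidean_space) chart set \<Rightarrow> bool"
  where "smooth_atlas \<A> \<longleftrightarrow>
    (\<Union>(U, \<phi>)\<in>\<A>. U) = UNIV \<and>
    (\<forall>(U, \<phi>)\<in>\<A>. open U \<and> open (\<phi> ` U) \<and> homeomorphism U (\<phi> ` U) \<phi> (inv_into U \<phi>)) \<and>
    (\<forall>(U, \<phi>)\<in>\<A>. \<forall>(V, \<psi>)\<in>\<A>. smooth_on (\<phi> ` (U \<inter> V)) (\<psi> \<circ> inv_into U \<phi>))"

text \<open>
  The manifold is the whole type \<open>'m\<close>; its dimension is that of \<open>'e\<close>.  Smoothness of the group
  operations is expressed in charts, together with their continuity.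
\<close>

locale lie_group = group gmult gunit ginv
  for gmult :: "'m::{t2_space, second_countable_topology} \<Rightarrow> 'm \<Rightarrow> 'm"
    and gunit :: 'm
    and ginv :: "'m \<Rightarrow> 'm" +
  fixes \<A> :: "('m, 'e::euclidean_space) chart set"
  assumes atlas: "smooth_atlas \<A>"
    and continuous_mult: "continuous_on UNIV (\<lambda>(x, y). gmult x y)"
    and continuous_inv: "continuous_on UNIV ginv"
    and smooth_mult:
      "\<lbrakk>(U, \<phi>) \<in> \<A>; (V, \<psi>) \<in> \<A>; (W, \<theta>) \<in> \<A>\<rbrakk> \<Longrightarrow>
        smooth_on {(\<phi> x, \<psi> y) | x y. x \<in> U \<and> y \<in> V \<and> gmult x y \<in> W}
          (\<lambda>(s, t). \<theta> (gmult (inv_into U \<phi> s) (inv_into V \<psi> t)))"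
    and smooth_inv:
      "\<lbrakk>(U, \<phi>) \<in> \<A>; (W, \<theta>) \<in> \<A>\<rbrakk> \<Longrightarrow>
        smooth_on {\<phi> x | x. x \<in> U \<and> ginv x \<in> W} (\<lambda>s. \<theta> (ginv (inv_into U \<phi> s)))"

text \<open>
  A bi-invariant Haar measure; on a second countable locally compact Hausdorff group a Borel measure
  that is finite on compact sets is automatically regular.
\<close>

definition unimodular :: "('m::topological_space \<Rightarrow> 'm \<Rightarrow> 'm) \<Rightarrow> bool"
  where "unimodular gmult \<longleftrightarrow> (\<exists>\<mu>. sets \<mu> = sets borel \<and>
    (\<forall>K. compact K \<longrightarrow> emeasure \<mu> K < \<infinity>) \<and>
    (\<forall>U. open U \<and> U \<noteq> {} \<longrightarrow> emeasure \<mu> U > 0) \<and>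
    (\<forall>a. \<forall>B\<in>sets borel. emeasure \<mu> ((\<lambda>x. gmult a x) ` B) = emeasure \<mu> B \<and>
                        emeasure \<mu> ((\<lambda>x. gmult x a) ` B) = emeasure \<mu> B))"

definition smooth_functions ::
    "('m::topological_space, 'e::euclidean_space) chart set \<Rightarrow> ('m \<Rightarrow> real) set"
  where "smooth_functions \<A> = {f. \<forall>(U, \<phi>)\<in>\<A>. smooth_on (\<phi> ` U) (f \<circ> inv_into U \<phi>)}"

text \<open>
  Tangent vectors only act on smooth functions; the value \<open>0\<close> elsewhere makes them a subspace of the
  function space, with the right equality.
\<close>

type_synonym 'm tangent = "('m \<Rightarrow> real) \<Rightarrow> real"
type_synonym 'm field = "'m \<Rightarrow> 'm tangent"

definition tangent_space ::
    "('m::topological_space, 'e::euclidean_space) chart set \<Rightarrow> 'm \<Rightarrow> 'm tangent set"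
  where "tangent_space \<A> p = {v.
    (\<forall>f\<in>smooth_functions \<A>. \<forall>h\<in>smooth_functions \<A>.
       v (\<lambda>q. f q + h q) = v f + v h \<and> v (\<lambda>q. f q * h q) = f p * v h + h p * v f) \<and>
    (\<forall>f\<in>smooth_functions \<A>. \<forall>c. v (\<lambda>q. c * f q) = c * v f) \<and>
    (\<forall>f. f \<notin> smooth_functions \<A> \<longrightarrow> v f = 0)}"

definition deriv_along :: "'m field \<Rightarrow> ('m \<Rightarrow> real) \<Rightarrow> 'm \<Rightarrow> real"
  where "deriv_along X f = (\<lambda>p. X p f)"

definition vector_fields ::
    "('m::topological_space, 'e::euclidean_space) chart set \<Rightarrow> 'm field set"
  where "vector_fields \<A> = {X. (\<forall>p. X p \<in> tangent_space \<A> p) \<and>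
    (\<forall>f\<in>smooth_functions \<A>. deriv_along X f \<in> smooth_functions \<A>)}"

definition fun_scale :: "('m \<Rightarrow> real) \<Rightarrow> 'm field \<Rightarrow> 'm field"
  where "fun_scale h X = (\<lambda>p. h p *\<^sub>R X p)"

definition lie_bracket :: "'m field \<Rightarrow> 'm field \<Rightarrow> 'm field"
  where "lie_bracket X Y = (\<lambda>p f. X p (deriv_along Y f) - Y p (deriv_along X f))"

type_synonym 'm metric = "'m \<Rightarrow> 'm tangent \<Rightarrow> 'm tangent \<Rightarrow> real"
type_synonym 'm endo = "'m \<Rightarrow> 'm tangent \<Rightarrow> 'm tangent"
type_synonym 'm connection = "'m field \<Rightarrow> 'm field \<Rightarrow> 'm field"
type_synonym 'm form2 = "'m field \<Rightarrow> 'm field \<Rightarrow> 'm \<Rightarrow> real"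

definition metric_app :: "'m metric \<Rightarrow> 'm form2"
  where "metric_app g X Y = (\<lambda>p. g p (X p) (Y p))"

definition endo_app :: "'m endo \<Rightarrow> 'm field \<Rightarrow> 'm field"
  where "endo_app J X = (\<lambda>p. J p (X p))"

text \<open>
  The pointwise frame \<open>u, v, w\<close> encodes nondegeneracy and the signature \<open>(+,+,-)\<close>, so this is the
  notion for three-dimensional manifolds.
\<close>

definition lorentzian_metric ::
    "('m::topological_space, 'e::euclidean_space) chart set \<Rightarrow> 'm metric \<Rightarrow> bool"
  where "lorentzian_metric \<A> g \<longleftrightarrow>
    (\<forall>p. \<forall>u\<in>tangent_space \<A> p. \<forall>v\<in>tangent_space \<A> p. g p u v = g p v u) \<and>
    (\<forall>p. \<forall>u\<in>tangent_space \<A> p. \<forall>v\<in>tangent_space \<A> p. \<forall>w\<in>tangent_space \<A> p. \<forall>a b.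
       g p (a *\<^sub>R u + b *\<^sub>R v) w = a * g p u w + b * g p v w) \<and>
    (\<forall>p. \<exists>u v w. span {u, v, w} = tangent_space \<A> p \<and>
       g p u u = 1 \<and> g p v v = 1 \<and> g p w w = -1 \<and> g p u v = 0 \<and> g p u w = 0 \<and> g p v w = 0) \<and>
    (\<forall>X\<in>vector_fields \<A>. \<forall>Y\<in>vector_fields \<A>. metric_app g X Y \<in> smooth_functions \<A>)"

definition endomorphism_field ::
    "('m::topological_space, 'e::euclidean_space) chart set \<Rightarrow> 'm endo \<Rightarrow> bool"
  where "endomorphism_field \<A> J \<longleftrightarrow>
    (\<forall>p. \<forall>u\<in>tangent_space \<A> p. J p u \<in> tangent_space \<A> p) \<and>
    (\<forall>p. \<forall>u\<in>tangent_space \<A> p. \<forall>v\<in>tangent_space \<A> p. \<forall>a b.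
       J p (a *\<^sub>R u + b *\<^sub>R v) = a *\<^sub>R J p u + b *\<^sub>R J p v) \<and>
    (\<forall>X\<in>vector_fields \<A>. endo_app J X \<in> vector_fields \<A>)"

definition product_structure ::
    "('m::topological_space, 'e::euclidean_space) chart set \<Rightarrow> 'm endo \<Rightarrow> bool"
  where "product_structure \<A> J \<longleftrightarrow> endomorphism_field \<A> J \<and>
    (\<forall>p. \<forall>u\<in>tangent_space \<A> p. J p (J p u) = u)"

definition affine_connection ::
    "('m::topological_space, 'e::euclidean_space) chart set \<Rightarrow> 'm connection \<Rightarrow> bool"
  where "affine_connection \<A> D \<longleftrightarrow>
    (\<forall>X\<in>vector_fields \<A>. \<forall>Y\<in>vector_fields \<A>. D X Y \<in> vector_fields \<A>) \<and>
    (\<forall>X\<in>vector_fields \<A>. \<forall>Y\<in>vector_fields \<A>. \<forall>Z\<in>vector_fields \<A>.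
       D (X + Y) Z = D X Z + D Y Z \<and> D X (Y + Z) = D X Y + D X Z) \<and>
    (\<forall>h\<in>smooth_functions \<A>. \<forall>X\<in>vector_fields \<A>. \<forall>Y\<in>vector_fields \<A>.
       D (fun_scale h X) Y = fun_scale h (D X Y) \<and>
       D X (fun_scale h Y) = fun_scale (deriv_along X h) Y + fun_scale h (D X Y))"

definition levi_civita_connection ::
    "('m::topological_space, 'e::euclidean_space) chart set \<Rightarrow> 'm metric \<Rightarrow> 'm connection \<Rightarrow> bool"
  where "levi_civita_connection \<A> g D \<longleftrightarrow> affine_connection \<A> D \<and>
    (\<forall>X\<in>vector_fields \<A>. \<forall>Y\<in>vector_fields \<A>. D X Y - D Y X = lie_bracket X Y) \<and>
    (\<forall>X\<in>vector_fields \<A>. \<forall>Y\<in>vector_fields \<A>. \<forall>Z\<in>vector_fields \<A>.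
       deriv_along X (metric_app g Y Z) = metric_app g (D X Y) Z + metric_app g Y (D X Z))"

text \<open>The field \<open>(\<nabla>\<^sub>X J) Y\<close>, where \<open>\<nabla> = D\<close>.\<close>

definition deriv_endo :: "'m connection \<Rightarrow> 'm endo \<Rightarrow> 'm field \<Rightarrow> 'm field \<Rightarrow> 'm field"
  where "deriv_endo D J X Y = D X (endo_app J Y) - endo_app J (D X Y)"

definition canonical_connection :: "'m connection \<Rightarrow> 'm endo \<Rightarrow> 'm connection"
  where "canonical_connection D J X Y =
    D X Y - (1/2) *\<^sub>R deriv_endo D J X (endo_app J Y)"

definition kobayashi_nomizu_connection :: "'m connection \<Rightarrow> 'm endo \<Rightarrow> 'm connection"
  where "kobayashi_nomizu_connection D J X Y =
    canonical_connection D J X Y -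
    (1/4) *\<^sub>R (deriv_endo D J Y (endo_app J X) - deriv_endo D J (endo_app J Y) X)"

definition curvature :: "'m connection \<Rightarrow> 'm field \<Rightarrow> 'm field \<Rightarrow> 'm field \<Rightarrow> 'm field"
  where "curvature D X Y Z = D X (D Y Z) - D Y (D X Z) - D (lie_bracket X Y) Z"

text \<open>Here \<open>e1, e2, e3\<close> is a pseudo-orthonormal frame with \<open>e3\<close> timelike.\<close>

definition ricci ::
    "'m metric \<Rightarrow> 'm connection \<Rightarrow> 'm field \<Rightarrow> 'm field \<Rightarrow> 'm field \<Rightarrow> 'm form2"
  where "ricci g D e1 e2 e3 X Y =
    - metric_app g (curvature D X e1 Y) e1
    - metric_app g (curvature D X e2 Y) e2
    + metric_app g (curvature D X e3 Y) e3"

definition sym_ricci ::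
    "'m metric \<Rightarrow> 'm connection \<Rightarrow> 'm field \<Rightarrow> 'm field \<Rightarrow> 'm field \<Rightarrow> 'm form2"
  where "sym_ricci g D e1 e2 e3 X Y =
    (1/2) *\<^sub>R (ricci g D e1 e2 e3 X Y + ricci g D e1 e2 e3 Y X)"

definition lie_derivative :: "'m field \<Rightarrow> 'm form2 \<Rightarrow> 'm form2"
  where "lie_derivative \<xi> T X Y =
    deriv_along \<xi> (T X Y) - T (lie_bracket \<xi> X) Y - T X (lie_bracket \<xi> Y)"

text \<open>
  The differential at \<open>p\<close> of left translation by \<open>a\<close>, mapping tangent vectors at \<open>p\<close> to tangent
  vectors at \<open>gmult a p\<close>; \<open>p\<close> is left implicit.
\<close>

definition left_push :: "('m \<Rightarrow> 'm \<Rightarrow> 'm) \<Rightarrow> 'm \<Rightarrow> 'm tangent \<Rightarrow> 'm tangent"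
  where "left_push gmult a v = (\<lambda>f. v (\<lambda>q. f (gmult a q)))"

definition left_invariant_fields ::
    "('m::topological_space, 'e::euclidean_space) chart set \<Rightarrow> ('m \<Rightarrow> 'm \<Rightarrow> 'm) \<Rightarrow> 'm field set"
  where "left_invariant_fields \<A> gmult =
    {X\<in>vector_fields \<A>. \<forall>a p. X (gmult a p) = left_push gmult a (X p)}"

definition left_invariant_metric ::
    "('m::topological_space, 'e::euclidean_space) chart set \<Rightarrow> ('m \<Rightarrow> 'm \<Rightarrow> 'm) \<Rightarrow> 'm metric \<Rightarrow> bool"
  where "left_invariant_metric \<A> gmult g \<longleftrightarrow>
    (\<forall>a p. \<forall>u\<in>tangent_space \<A> p. \<forall>v\<in>tangent_space \<A> p.
       g (gmult a p) (left_push gmult a u) (left_push gmult a v) = g p u v)"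

definition left_invariant_endo ::
    "('m::topological_space, 'e::euclidean_space) chart set \<Rightarrow> ('m \<Rightarrow> 'm \<Rightarrow> 'm) \<Rightarrow> 'm endo \<Rightarrow> bool"
  where "left_invariant_endo \<A> gmult J \<longleftrightarrow>
    (\<forall>a p. \<forall>u\<in>tangent_space \<A> p.
       J (gmult a p) (left_push gmult a u) = left_push gmult a (J p u))"

definition pseudo_orthonormal :: "'m metric \<Rightarrow> 'm field \<Rightarrow> 'm field \<Rightarrow> 'm field \<Rightarrow> bool"
  where "pseudo_orthonormal g e1 e2 e3 \<longleftrightarrow>
    metric_app g e1 e1 = (\<lambda>p. 1) \<and> metric_app g e2 e2 = (\<lambda>p. 1) \<and>
    metric_app g e3 e3 = (\<lambda>p. -1) \<and> metric_app g e1 e2 = (\<lambda>p. 0) \<and>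
    metric_app g e1 e3 = (\<lambda>p. 0) \<and> metric_app g e2 e3 = (\<lambda>p. 0)"

definition ricci_collineations ::
    "('m::topological_space, 'e::euclidean_space) chart set \<Rightarrow> ('m \<Rightarrow> 'm \<Rightarrow> 'm) \<Rightarrow> 'm metric \<Rightarrow>
     'm connection \<Rightarrow> 'm field \<Rightarrow> 'm field \<Rightarrow> 'm field \<Rightarrow> 'm field set"
  where "ricci_collineations \<A> gmult g D e1 e2 e3 =
    {\<xi>\<in>left_invariant_fields \<A> gmult. \<forall>X\<in>vector_fields \<A>. \<forall>Y\<in>vector_fields \<A>.
       lie_derivative \<xi> (sym_ricci g D e1 e2 e3) X Y = (\<lambda>p. 0)}"

text \<open>The zero field is always a collineation, so admitting one means having a nonzero one.\<close>

definition admits_ricci_collineations ::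
    "('m::topological_space, 'e::euclidean_space) chart set \<Rightarrow> ('m \<Rightarrow> 'm \<Rightarrow> 'm) \<Rightarrow> 'm metric \<Rightarrow>
     'm connection \<Rightarrow> 'm field \<Rightarrow> 'm field \<Rightarrow> 'm field \<Rightarrow> bool"
  where "admits_ricci_collineations \<A> gmult g D e1 e2 e3 \<longleftrightarrow>
    (\<exists>\<xi>\<in>ricci_collineations \<A> gmult g D e1 e2 e3. \<xi> \<noteq> 0)"

end

theory Submission
  imports Defs
begin

text \<open>
  The Lie derivative of the symmetrized Ricci tensor is bilinear over the smooth functions, and the
  frame spans every tangent space, so a left-invariant \<open>\<xi>\<close> is a collineation as soon as the Lie
  derivative vanishes on pairs of frame fields. On constant combinations of the frame all the
  operations involved are given by constants: the Koszul equations determine the Levi-Civita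
  connection, hence the Kobayashi-Nomizu connection, its Ricci tensor, and finally five homogeneous
  linear equations for the coefficients of \<open>\<xi>\<close>. They force \<open>\<lambda>\<^sub>1 = 0\<close> because \<open>\<gamma> \<noteq> 0\<close>, and for
  \<open>\<alpha>\<beta> \<noteq> 0\<close> eliminating \<open>\<lambda>\<^sub>3\<close> leaves \<open>(\<beta>\<^sup>2 + \<gamma>\<^sup>2) (\<alpha> - 4\<beta>) \<lambda>\<^sub>2 = 0\<close>.
\<close>

section \<open>Smooth functions\<close>

text \<open>\<open>frechet_derivative\<close> is a choice from the predicate of being a derivative
  at \<open>x\<close>. That predicate only sees a neighbourhood of \<open>x\<close>, so it is the
  same for \<open>f\<close> and \<open>g\<close>, and so is the choice.\<close>

lemma frechet_derivative_cong_open: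
  assumes "open S" "x \<in> S" "\<And>y. y \<in> S \<Longrightarrow> f y = g y"
  shows "frechet_derivative f (at x) = frechet_derivative g (at x)"
proof -
  have "(f has_derivative f') (at x) \<longleftrightarrow> (g has_derivative f') (at x)" for f'
    using has_derivative_transform_within_open[of f f' x UNIV S g]
      has_derivative_transform_within_open[of g f' x UNIV S f] assms by auto
  then show ?thesis
    unfolding frechet_derivative_def by simp
qed

text \<open>Serves to replace the derivative of a sum or product by the usual formula, which is
  available at the points of \<open>S\<close>. Since \<open>S\<close> is open, the derivatives of
  \<open>f\<close> and \<open>g\<close> agree there too, and the induction passes to them.\<close>

lemma Ck_on_cong:
  assumes "open S" "\<And>x. x \<in> S \<Longrightarrow> f x = g x" "Ck_on k S f"
  shows "Ck_on k S g"
  using assms(2,3)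
proof (induction k arbitrary: f g)
  case 0
  then show ?case by (simp cong: continuous_on_cong)
next
  case (Suc k)
  have "g differentiable_on S"
    using Suc.prems has_derivative_transform[of _ S g f]
    by (fastforce simp: differentiable_on_def differentiable_def)
  moreover have "Ck_on k S (\<lambda>x. frechet_derivative g (at x) v)" for v
  proof (rule Suc.IH)
    show "Ck_on k S (\<lambda>x. frechet_derivative f (at x) v)"
      using Suc.prems(2) by simp
    show "frechet_derivative f (at x) v = frechet_derivative g (at x) v" if "x \<in> S" for x
      using frechet_derivative_cong_open[OF assms(1) that Suc.prems(1)] by simp
  qed
  ultimately show ?case by simp
qed

lemma Ck_on_Suc_imp: "Ck_on (Suc k) S f \<Longrightarrow> Ck_on k S f"
  by (induction k arbitrary: f) (auto simp: differentiable_imp_continuous_on)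

lemma Ck_on_const: "Ck_on k S (\<lambda>x. c)"
  by (induction k arbitrary: c) (auto simp: differentiable_on_def)

lemma Ck_on_add:
  assumes "open S" "Ck_on k S f" "Ck_on k S g"
  shows "Ck_on k S (\<lambda>x. f x + g x)"
  using assms(2,3)
proof (induction k arbitrary: f g)
  case 0
  then show ?case by (simp add: continuous_on_add)
next
  case (Suc k)
  have d: "f differentiable at x" "g differentiable at x" if "x \<in> S" for x
    using Suc.prems that assms(1) by (auto simp: differentiable_on_eq_differentiable_at)
  have "Ck_on k S (\<lambda>x. frechet_derivative (\<lambda>y. f y + g y) (at x) v)" for v
  proof (rule Ck_on_cong[OF assms(1)])
    show "Ck_on k S (\<lambda>x. frechet_derivative f (at x) v + frechet_derivative g (at x) v)"
      using Suc.prems by (simp add: Suc.IH)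
    show "frechet_derivative f (at x) v + frechet_derivative g (at x) v =
        frechet_derivative (\<lambda>y. f y + g y) (at x) v" if "x \<in> S" for x
      using frechet_derivative_at[OF has_derivative_add[OF
          d[OF that, unfolded frechet_derivative_works]]]
      by (metis (no_types, lifting))
  qed
  then show ?case using Suc.prems by (simp add: differentiable_on_add)
qed

lemma Ck_on_mult:
  fixes f g :: "'a::real_normed_vector \<Rightarrow> real"
  assumes "open S" "Ck_on k S f" "Ck_on k S g"
  shows "Ck_on k S (\<lambda>x. f x * g x)"
  using assms(2,3)
proof (induction k arbitrary: f g)
  case 0
  then show ?case by (simp add: continuous_on_mult)
next
  case (Suc k)
  have d: "f differentiable at x" "g differentiable at x" if "x \<in> S" for x
    using Suc.prems that assms(1) by (auto simp: differentiable_on_eq_differentiable_at)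
  have "frechet_derivative (\<lambda>y. f y * g y) (at x) v =
      f x * frechet_derivative g (at x) v + frechet_derivative f (at x) v * g x" if "x \<in> S" for x v
    using frechet_derivative_at[OF has_derivative_mult[OF
        d[OF that, unfolded frechet_derivative_works]]]
    by (metis (no_types, lifting))
  \<comment> \<open>The Leibniz rule keeps undifferentiated factors \<open>f\<close> and
    \<open>g\<close>; \<open>Ck_on_Suc_imp\<close> lowers them to class \<open>k\<close> so that the
    induction hypothesis applies.\<close>
  moreover have "Ck_on k S (\<lambda>x. f x * frechet_derivative g (at x) v + frechet_derivative f (at x) v * g x)" for v
    using Suc.prems Suc.prems[THEN Ck_on_Suc_imp] by (simp add: Ck_on_add Suc.IH assms(1))
  ultimately have "Ck_on k S (\<lambda>x. frechet_derivative (\<lambda>y. f y * g y) (at x) v)" for v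
    using Ck_on_cong[OF assms(1)] by (metis (no_types, lifting))
  then show ?case using Suc.prems by (simp add: differentiable_on_mult)
qed

locale smooth_manifold =
  fixes \<A> :: "('m::topological_space, 'e::euclidean_space) chart set"
  assumes smooth_atlas: "smooth_atlas \<A>"
begin

lemma chart_image_open: "(U, \<phi>) \<in> \<A> \<Longrightarrow> open (\<phi> ` U)"
  using smooth_atlas unfolding smooth_atlas_def by fast

lemma smooth_functions_const: "(\<lambda>p. c) \<in> smooth_functions \<A>"
  by (auto simp: smooth_functions_def smooth_on_def o_def Ck_on_const)

lemma smooth_functions_add:
  "f \<in> smooth_functions \<A> \<Longrightarrow> h \<in> smooth_functions \<A> \<Longrightarrow> (\<lambda>p. f p + h p) \<in> smooth_functions \<A>"
  using chart_image_open by (fastforce simp: smooth_functions_def smooth_on_def o_def intro: Ck_on_add)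

lemma smooth_functions_mult:
  "f \<in> smooth_functions \<A> \<Longrightarrow> h \<in> smooth_functions \<A> \<Longrightarrow> (\<lambda>p. f p * h p) \<in> smooth_functions \<A>"
  using chart_image_open by (fastforce simp: smooth_functions_def smooth_on_def o_def intro: Ck_on_mult)

lemma smooth_functions_scale:
  "f \<in> smooth_functions \<A> \<Longrightarrow> (\<lambda>p. c * f p) \<in> smooth_functions \<A>"
  using smooth_functions_mult smooth_functions_const by blast

lemma smooth_functions_diff:
  assumes "f \<in> smooth_functions \<A>" "h \<in> smooth_functions \<A>"
  shows "(\<lambda>p. f p - h p) \<in> smooth_functions \<A>"
  using smooth_functions_add[OF assms(1) smooth_functions_scale[OF assms(2), of "-1"]] by simp

end

section \<open>Vector fields\<close>

lemma scaleR_fun_apply: "(c *\<^sub>R f) x = c *\<^sub>R f x"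
  by (simp add: scaleR_fun_def)

lemma fun_scale_apply: "fun_scale h X p f = h p * X p f"
  by (simp add: fun_scale_def scaleR_fun_apply)

lemmas field_apply = scaleR_fun_apply fun_scale_apply plus_fun_apply minus_apply uminus_apply
  zero_fun_apply

text \<open>Real multiples become multiples by constant functions, so the rules for
  \<open>fun_scale\<close> also cover real scalars.\<close>

lemma scaleR_eq_fun_scale: "(c *\<^sub>R X :: 'm field) = fun_scale (\<lambda>p. c) X"
  by (simp add: fun_eq_iff field_apply)

lemma minus_eq_fun_scale: "(- X :: 'm field) = fun_scale (\<lambda>p. -1) X"
  by (simp add: fun_eq_iff field_apply)

context smooth_manifold
begin

lemma tangent_add:
  "\<lbrakk>v \<in> tangent_space \<A> p; f \<in> smooth_functions \<A>; h \<in> smooth_functions \<A>\<rbrakk> \<Longrightarrow>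
    v (\<lambda>q. f q + h q) = v f + v h"
  by (simp add: tangent_space_def)

lemma tangent_mult:
  "\<lbrakk>v \<in> tangent_space \<A> p; f \<in> smooth_functions \<A>; h \<in> smooth_functions \<A>\<rbrakk> \<Longrightarrow>
    v (\<lambda>q. f q * h q) = f p * v h + h p * v f"
  by (simp add: tangent_space_def)

lemma tangent_scale:
  "\<lbrakk>v \<in> tangent_space \<A> p; f \<in> smooth_functions \<A>\<rbrakk> \<Longrightarrow> v (\<lambda>q. c * f q) = c * v f"
  by (simp add: tangent_space_def)

lemma tangent_nonsmooth:
  "\<lbrakk>v \<in> tangent_space \<A> p; f \<notin> smooth_functions \<A>\<rbrakk> \<Longrightarrow> v f = 0"
  by (simp add: tangent_space_def)

text \<open>The product rule for \<open>1 * 1\<close> shows that the value at the constant one is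
  twice itself, hence zero; every constant is a multiple of one.\<close>

lemma tangent_const:
  assumes "v \<in> tangent_space \<A> p"
  shows "v (\<lambda>q. c) = 0"
  using tangent_mult[OF assms smooth_functions_const smooth_functions_const, of 1 1]
    tangent_scale[OF assms smooth_functions_const, of c 1] by simp

lemma field_tangent: "X \<in> vector_fields \<A> \<Longrightarrow> X p \<in> tangent_space \<A> p"
  by (simp add: vector_fields_def)

lemma field_smooth:
  "X \<in> vector_fields \<A> \<Longrightarrow> f \<in> smooth_functions \<A> \<Longrightarrow> (\<lambda>p. X p f) \<in> smooth_functions \<A>"
  by (simp add: vector_fields_def deriv_along_def)

lemmas field_derivation = tangent_add[OF field_tangent] tangent_mult[OF field_tangent]
  tangent_scale[OF field_tangent] tangent_const[OF field_tangent] tangent_nonsmooth[OF field_tangent]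
  field_smooth

lemma deriv_along_const: "X \<in> vector_fields \<A> \<Longrightarrow> deriv_along X (\<lambda>p. c) = (\<lambda>p. 0)"
  by (simp add: deriv_along_def tangent_const[OF field_tangent])

lemma tangent_spaceI:
  assumes "\<And>f h. f \<in> smooth_functions \<A> \<Longrightarrow> h \<in> smooth_functions \<A> \<Longrightarrow> v (\<lambda>q. f q + h q) = v f + v h"
    and "\<And>f h. f \<in> smooth_functions \<A> \<Longrightarrow> h \<in> smooth_functions \<A> \<Longrightarrow> v (\<lambda>q. f q * h q) = f p * v h + h p * v f"
    and "\<And>f c. f \<in> smooth_functions \<A> \<Longrightarrow> v (\<lambda>q. c * f q) = c * v f"
    and "\<And>f. f \<notin> smooth_functions \<A> \<Longrightarrow> v f = 0"
  shows "v \<in> tangent_space \<A> p"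
  using assms by (simp add: tangent_space_def)

lemma subspace_tangent_space: "subspace (tangent_space \<A> p)"
  unfolding subspace_def
  by (auto intro!: tangent_spaceI simp: field_apply tangent_add tangent_mult tangent_scale
      tangent_nonsmooth algebra_simps)

lemma vector_fieldsI:
  assumes "\<And>p. X p \<in> tangent_space \<A> p"
    and "\<And>f. f \<in> smooth_functions \<A> \<Longrightarrow> (\<lambda>p. X p f) \<in> smooth_functions \<A>"
  shows "X \<in> vector_fields \<A>"
  using assms by (simp add: vector_fields_def deriv_along_def)

lemma vector_fields_fun_scale:
  assumes "h \<in> smooth_functions \<A>" "X \<in> vector_fields \<A>"
  shows "fun_scale h X \<in> vector_fields \<A>"
proof (rule vector_fieldsI)
  show "fun_scale h X p \<in> tangent_space \<A> p" for p
    unfolding fun_scale_def using subspace_scale[OF subspace_tangent_space field_tangent] assms by blast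
  show "(\<lambda>p. fun_scale h X p f) \<in> smooth_functions \<A>" if "f \<in> smooth_functions \<A>" for f
    unfolding fun_scale_apply using smooth_functions_mult[OF assms(1) field_smooth[OF assms(2) that]] .
qed

lemma vector_fields_add:
  assumes "X \<in> vector_fields \<A>" "Y \<in> vector_fields \<A>"
  shows "X + Y \<in> vector_fields \<A>"
proof (rule vector_fieldsI)
  show "(X + Y) p \<in> tangent_space \<A> p" for p
    using subspace_add[OF subspace_tangent_space field_tangent field_tangent] assms
    by (simp only: plus_fun_apply)
  show "(\<lambda>p. (X + Y) p f) \<in> smooth_functions \<A>" if "f \<in> smooth_functions \<A>" for f
    unfolding plus_fun_apply using smooth_functions_add[OF assms[THEN field_smooth, OF that]] .
qed

lemma vector_fields_scaleR: "X \<in> vector_fields \<A> \<Longrightarrow> c *\<^sub>R X \<in> vector_fields \<A>"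
  by (simp add: scaleR_eq_fun_scale vector_fields_fun_scale smooth_functions_const)

lemma vector_fields_minus: "X \<in> vector_fields \<A> \<Longrightarrow> - X \<in> vector_fields \<A>"
  by (simp add: minus_eq_fun_scale vector_fields_fun_scale smooth_functions_const)

lemma vector_fields_diff:
  "X \<in> vector_fields \<A> \<Longrightarrow> Y \<in> vector_fields \<A> \<Longrightarrow> X - Y \<in> vector_fields \<A>"
  using vector_fields_add[OF _ vector_fields_minus] by fastforce

text \<open>Each field turns a nonsmooth function into the constant zero, which the other field
  annihilates. This provides the default value required of tangent vectors.\<close>

lemma lie_bracket_nonsmooth:
  assumes "X \<in> vector_fields \<A>" "Y \<in> vector_fields \<A>" "f \<notin> smooth_functions \<A>"
  shows "lie_bracket X Y p f = 0"
  using assms(3)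
  by (simp add: lie_bracket_def deriv_along_def field_derivation[OF assms(1)] field_derivation[OF assms(2)])

text \<open>A composite of two derivations violates the product rule by mixed terms that are
  symmetric in the two fields, so the commutator is again a derivation.\<close>

lemma vector_fields_lie_bracket:
  assumes "X \<in> vector_fields \<A>" "Y \<in> vector_fields \<A>"
  shows "lie_bracket X Y \<in> vector_fields \<A>"
proof (rule vector_fieldsI)
  note field = field_derivation[OF assms(1)] field_derivation[OF assms(2)]
    smooth_functions_mult smooth_functions_scale
  show "lie_bracket X Y p \<in> tangent_space \<A> p" for p
  proof (rule tangent_spaceI)
    fix f h assume "f \<in> smooth_functions \<A>" "h \<in> smooth_functions \<A>"
    with assms show "lie_bracket X Y p (\<lambda>q. f q + h q) = lie_bracket X Y p f + lie_bracket X Y p h"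
      "lie_bracket X Y p (\<lambda>q. f q * h q) = f p * lie_bracket X Y p h + h p * lie_bracket X Y p f"
      by (simp_all add: lie_bracket_def deriv_along_def field algebra_simps)
  next
    fix f c assume "f \<in> smooth_functions \<A>"
    with assms show "lie_bracket X Y p (\<lambda>q. c * f q) = c * lie_bracket X Y p f"
      by (simp add: lie_bracket_def deriv_along_def field algebra_simps)
  qed (simp add: lie_bracket_nonsmooth assms)
  show "(\<lambda>p. lie_bracket X Y p f) \<in> smooth_functions \<A>" if "f \<in> smooth_functions \<A>" for f
    unfolding lie_bracket_def deriv_along_def
    using smooth_functions_diff[OF
        field_smooth[OF assms(1) field_smooth[OF assms(2) that]]
        field_smooth[OF assms(2) field_smooth[OF assms(1) that]]] .
qed

lemma lie_bracket_fun_scale_left: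
  assumes "h \<in> smooth_functions \<A>" "X \<in> vector_fields \<A>" "Y \<in> vector_fields \<A>"
  shows "lie_bracket (fun_scale h X) Y = fun_scale h (lie_bracket X Y) - fun_scale (deriv_along Y h) X"
proof (intro ext)
  fix p f
  show "lie_bracket (fun_scale h X) Y p f =
    (fun_scale h (lie_bracket X Y) - fun_scale (deriv_along Y h) X) p f"
  \<comment> \<open>Equality of fields is tested on all functions: the Leibniz computation covers
    smooth \<open>f\<close>, and the default value zero covers the others.\<close>
  proof (cases "f \<in> smooth_functions \<A>")
    case True
    then show ?thesis
      using assms(1) by (simp add: lie_bracket_def deriv_along_def field_apply
          field_derivation[OF assms(2)] field_derivation[OF assms(3)] algebra_simps)
  next
    case False
    then show ?thesis
      using assms by (simp add: lie_bracket_nonsmooth vector_fields_fun_scale field_apply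
          field_derivation[OF assms(2)])
  qed
qed

lemma lie_bracket_antisym: "lie_bracket X Y = - lie_bracket Y X"
  by (simp add: lie_bracket_def fun_eq_iff)

lemma lie_bracket_fun_scale_right:
  assumes "h \<in> smooth_functions \<A>" "X \<in> vector_fields \<A>" "Y \<in> vector_fields \<A>"
  shows "lie_bracket X (fun_scale h Y) = fun_scale h (lie_bracket X Y) + fun_scale (deriv_along X h) Y"
  using lie_bracket_fun_scale_left[OF assms(1,3,2)]
  by (simp add: lie_bracket_antisym[of X] fun_eq_iff field_apply)

lemma lie_bracket_add_left:
  assumes "X \<in> vector_fields \<A>" "Y \<in> vector_fields \<A>" "Z \<in> vector_fields \<A>"
  shows "lie_bracket (X + Y) Z = lie_bracket X Z + lie_bracket Y Z"
proof (intro ext)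
  fix p f
  show "lie_bracket (X + Y) Z p f = (lie_bracket X Z + lie_bracket Y Z) p f"
  proof (cases "f \<in> smooth_functions \<A>")
    case True
    then show ?thesis
      by (simp add: lie_bracket_def deriv_along_def field_apply field_derivation[OF assms(1)]
          field_derivation[OF assms(2)] field_derivation[OF assms(3)])
  next
    case False
    then show ?thesis
      using assms by (simp add: lie_bracket_nonsmooth vector_fields_add field_apply)
  qed
qed

lemma lie_bracket_add_right:
  assumes "X \<in> vector_fields \<A>" "Y \<in> vector_fields \<A>" "Z \<in> vector_fields \<A>"
  shows "lie_bracket X (Y + Z) = lie_bracket X Y + lie_bracket X Z"
  using lie_bracket_add_left[OF assms(2,3,1)]
  by (simp add: lie_bracket_antisym[of X])

end

section \<open>Connections and curvature\<close>

lemma deriv_along_lie_bracket: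
  "deriv_along (lie_bracket X Y) f = (\<lambda>p. deriv_along X (deriv_along Y f) p - deriv_along Y (deriv_along X f) p)"
  by (simp add: deriv_along_def lie_bracket_def)

context smooth_manifold
begin

lemma deriv_along_smooth:
  "X \<in> vector_fields \<A> \<Longrightarrow> f \<in> smooth_functions \<A> \<Longrightarrow> deriv_along X f \<in> smooth_functions \<A>"
  by (simp add: vector_fields_def)

lemma affine_connection_rules:
  assumes "affine_connection \<A> D" "X \<in> vector_fields \<A>" "Y \<in> vector_fields \<A>"
  shows "D X Y \<in> vector_fields \<A>"
    and "Z \<in> vector_fields \<A> \<Longrightarrow> D (X + Y) Z = D X Z + D Y Z"
    and "Z \<in> vector_fields \<A> \<Longrightarrow> D X (Y + Z) = D X Y + D X Z"
    and "h \<in> smooth_functions \<A> \<Longrightarrow> D (fun_scale h X) Y = fun_scale h (D X Y)"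
    and "h \<in> smooth_functions \<A> \<Longrightarrow>
      D X (fun_scale h Y) = fun_scale (deriv_along X h) Y + fun_scale h (D X Y)"
  using assms unfolding affine_connection_def by blast+

lemma affine_connection_scaleR:
  assumes "affine_connection \<A> D" "X \<in> vector_fields \<A>" "Y \<in> vector_fields \<A>"
  shows "D (c *\<^sub>R X) Y = c *\<^sub>R D X Y" "D X (c *\<^sub>R Y) = c *\<^sub>R D X Y"
  using assms
  by (simp_all add: scaleR_eq_fun_scale affine_connection_rules smooth_functions_const deriv_along_const)
    (simp add: fun_eq_iff field_apply)

lemma affine_connection_minus:
  assumes "affine_connection \<A> D" "X \<in> vector_fields \<A>" "Y \<in> vector_fields \<A>"
  shows "D (- X) Y = - D X Y" "D X (- Y) = - D X Y"
  using affine_connection_scaleR[OF assms, of "-1"] by simp_all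

lemma affine_connection_diff:
  assumes "affine_connection \<A> D" "X \<in> vector_fields \<A>" "Y \<in> vector_fields \<A>" "Z \<in> vector_fields \<A>"
  shows "D (X - Y) Z = D X Z - D Y Z" "D X (Y - Z) = D X Y - D X Z"
  using affine_connection_rules(2)[OF assms(1,2) vector_fields_minus[OF assms(3)] assms(4)]
    affine_connection_rules(3)[OF assms(1,2,3) vector_fields_minus[OF assms(4)]]
    affine_connection_minus[OF assms(1)] assms by simp_all

lemma vector_fields_curvature:
  assumes "affine_connection \<A> D" "X \<in> vector_fields \<A>" "Y \<in> vector_fields \<A>" "Z \<in> vector_fields \<A>"
  shows "curvature D X Y Z \<in> vector_fields \<A>"
  unfolding curvature_def using assms
  by (simp add: vector_fields_diff vector_fields_lie_bracket affine_connection_rules)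

text \<open>The first and third slots are the ones that matter: the Ricci tensor has frame fields in
  the second.\<close>

lemma curvature_add:
  assumes "affine_connection \<A> D" "X \<in> vector_fields \<A>" "Y \<in> vector_fields \<A>" "Z \<in> vector_fields \<A>"
    "W \<in> vector_fields \<A>"
  shows "curvature D (X + W) Y Z = curvature D X Y Z + curvature D W Y Z"
    and "curvature D X Y (Z + W) = curvature D X Y Z + curvature D X Y W"
  using assms
  by (simp_all add: curvature_def affine_connection_rules[OF assms(1)] lie_bracket_add_left
      vector_fields_lie_bracket vector_fields_add)

text \<open>In the first slot the derivative of \<open>h\<close> produced by
  \<open>D Y (fun_scale h (D X Z))\<close> cancels against the one in the bracket. In the third slot
  the first derivatives cancel by symmetry, and the second derivatives cancel against
  \<open>deriv_along (lie_bracket X Y) h\<close>.\<close>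

lemma curvature_fun_scale:
  assumes "affine_connection \<A> D" "X \<in> vector_fields \<A>" "Y \<in> vector_fields \<A>" "Z \<in> vector_fields \<A>"
    "h \<in> smooth_functions \<A>"
  shows "curvature D (fun_scale h X) Y Z = fun_scale h (curvature D X Y Z)"
    and "curvature D X Y (fun_scale h Z) = fun_scale h (curvature D X Y Z)"
proof -
  note D = affine_connection_rules[OF assms(1)] affine_connection_diff[OF assms(1)]
    vector_fields_lie_bracket vector_fields_fun_scale deriv_along_smooth
  show "curvature D (fun_scale h X) Y Z = fun_scale h (curvature D X Y Z)"
    using assms by (simp add: curvature_def lie_bracket_fun_scale_left D)
      (simp add: fun_eq_iff field_apply algebra_simps)
  show "curvature D X Y (fun_scale h Z) = fun_scale h (curvature D X Y Z)"
    using assms by (simp add: curvature_def D vector_fields_add)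
      (simp add: fun_eq_iff field_apply algebra_simps deriv_along_lie_bracket)
qed

section \<open>Endomorphism fields and the Kobayashi-Nomizu connection\<close>

lemma endo_app_rules:
  assumes "endomorphism_field \<A> J" "X \<in> vector_fields \<A>"
  shows "endo_app J X \<in> vector_fields \<A>"
    and "Y \<in> vector_fields \<A> \<Longrightarrow> endo_app J (X + Y) = endo_app J X + endo_app J Y"
    and "endo_app J (fun_scale h X) = fun_scale h (endo_app J X)"
proof -
  show "endo_app J X \<in> vector_fields \<A>"
    using assms by (simp add: endomorphism_field_def)
  have lin: "J p (a *\<^sub>R u + b *\<^sub>R v) = a *\<^sub>R J p u + b *\<^sub>R J p v"
    if "u \<in> tangent_space \<A> p" "v \<in> tangent_space \<A> p" for p u v a b
    using assms(1) that unfolding endomorphism_field_def by blast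
  show "endo_app J (X + Y) = endo_app J X + endo_app J Y" if "Y \<in> vector_fields \<A>"
    using lin[OF field_tangent[OF assms(2)] field_tangent[OF that], of _ 1 1]
    by (simp add: endo_app_def fun_eq_iff)
  show "endo_app J (fun_scale h X) = fun_scale h (endo_app J X)"
    using lin[OF field_tangent[OF assms(2)] field_tangent[OF assms(2)], of _ _ 0]
    by (simp add: endo_app_def fun_scale_def)
qed

lemma vector_fields_deriv_endo:
  assumes "affine_connection \<A> D" "endomorphism_field \<A> J" "X \<in> vector_fields \<A>" "Y \<in> vector_fields \<A>"
  shows "deriv_endo D J X Y \<in> vector_fields \<A>"
  using assms by (simp add: deriv_endo_def vector_fields_diff affine_connection_rules endo_app_rules)

lemma deriv_endo_add:
  assumes "affine_connection \<A> D" "endomorphism_field \<A> J" "X \<in> vector_fields \<A>" "Y \<in> vector_fields \<A>"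
    "Z \<in> vector_fields \<A>"
  shows "deriv_endo D J (X + Y) Z = deriv_endo D J X Z + deriv_endo D J Y Z"
    and "deriv_endo D J X (Y + Z) = deriv_endo D J X Y + deriv_endo D J X Z"
  using assms
  by (simp_all add: deriv_endo_def affine_connection_rules[OF assms(1)] endo_app_rules[OF assms(2)])

text \<open>Scaling \<open>Y\<close> by \<open>h\<close> adds the same term
  \<open>fun_scale (deriv_along X h) (endo_app J Y)\<close> to \<open>D X (endo_app J Y)\<close> and
  to \<open>endo_app J (D X Y)\<close>, so it drops out of the difference.\<close>

lemma deriv_endo_fun_scale:
  assumes "affine_connection \<A> D" "endomorphism_field \<A> J" "X \<in> vector_fields \<A>" "Y \<in> vector_fields \<A>"
    "h \<in> smooth_functions \<A>"
  shows "deriv_endo D J (fun_scale h X) Y = fun_scale h (deriv_endo D J X Y)"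
    and "deriv_endo D J X (fun_scale h Y) = fun_scale h (deriv_endo D J X Y)"
  using assms
  by (simp_all add: deriv_endo_def affine_connection_rules[OF assms(1)] endo_app_rules[OF assms(2)]
      vector_fields_fun_scale deriv_along_smooth)
    (simp_all add: fun_eq_iff field_apply algebra_simps)

text \<open>The correction added to \<open>D\<close> is bilinear over the smooth functions, so the
  Leibniz rule of \<open>D\<close> persists.\<close>

lemma affine_connection_kobayashi_nomizu:
  assumes "affine_connection \<A> D" "endomorphism_field \<A> J"
  shows "affine_connection \<A> (kobayashi_nomizu_connection D J)"
proof -
  note rules = affine_connection_rules[OF assms(1)] endo_app_rules[OF assms(2)]
    vector_fields_deriv_endo[OF assms] deriv_endo_add[OF assms] deriv_endo_fun_scale[OF assms]
    vector_fields_add vector_fields_diff vector_fields_scaleR vector_fields_fun_scale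
    kobayashi_nomizu_connection_def canonical_connection_def
  show ?thesis
    unfolding affine_connection_def
  proof (intro conjI ballI)
    fix X Y assume XY: "X \<in> vector_fields \<A>" "Y \<in> vector_fields \<A>"
    then show "kobayashi_nomizu_connection D J X Y \<in> vector_fields \<A>"
      by (simp add: rules)
    fix Z assume "Z \<in> vector_fields \<A>"
    with XY show "kobayashi_nomizu_connection D J (X + Y) Z =
        kobayashi_nomizu_connection D J X Z + kobayashi_nomizu_connection D J Y Z"
      "kobayashi_nomizu_connection D J X (Y + Z) =
        kobayashi_nomizu_connection D J X Y + kobayashi_nomizu_connection D J X Z"
      by (simp_all add: rules) (simp_all add: algebra_simps)
  next
    fix h X Y assume "h \<in> smooth_functions \<A>" "X \<in> vector_fields \<A>" "Y \<in> vector_fields \<A>"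
    then show "kobayashi_nomizu_connection D J (fun_scale h X) Y =
        fun_scale h (kobayashi_nomizu_connection D J X Y)"
      "kobayashi_nomizu_connection D J X (fun_scale h Y) =
        fun_scale (deriv_along X h) Y + fun_scale h (kobayashi_nomizu_connection D J X Y)"
      by (simp_all add: rules) (simp_all add: fun_eq_iff field_apply algebra_simps)
  qed
qed

end

section \<open>Tensorial bilinear forms\<close>

text \<open>A \<open>form2\<close> is merely a map on fields; bilinearity over the smooth functions
  expresses that it is a tensor, which allows testing it on a frame.\<close>

definition tensorial_form ::
    "('m::topological_space, 'e::euclidean_space) chart set \<Rightarrow> 'm form2 \<Rightarrow> bool"
  where "tensorial_form \<A> T \<longleftrightarrow>
    (\<forall>X\<in>vector_fields \<A>. \<forall>Y\<in>vector_fields \<A>. T X Y \<in> smooth_functions \<A>) \<and>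
    (\<forall>X\<in>vector_fields \<A>. \<forall>Y\<in>vector_fields \<A>. \<forall>Z\<in>vector_fields \<A>.
       T (X + Y) Z = T X Z + T Y Z \<and> T X (Y + Z) = T X Y + T X Z) \<and>
    (\<forall>h\<in>smooth_functions \<A>. \<forall>X\<in>vector_fields \<A>. \<forall>Y\<in>vector_fields \<A>.
       T (fun_scale h X) Y = (\<lambda>p. h p * T X Y p) \<and> T X (fun_scale h Y) = (\<lambda>p. h p * T X Y p))"

context smooth_manifold
begin

lemma tensorial_formD:
  assumes "tensorial_form \<A> T" "X \<in> vector_fields \<A>" "Y \<in> vector_fields \<A>"
  shows "T X Y \<in> smooth_functions \<A>"
    and "Z \<in> vector_fields \<A> \<Longrightarrow> T (X + Y) Z = T X Z + T Y Z"
    and "Z \<in> vector_fields \<A> \<Longrightarrow> T X (Y + Z) = T X Y + T X Z"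
    and "h \<in> smooth_functions \<A> \<Longrightarrow> T (fun_scale h X) Y = (\<lambda>p. h p * T X Y p)"
    and "h \<in> smooth_functions \<A> \<Longrightarrow> T X (fun_scale h Y) = (\<lambda>p. h p * T X Y p)"
  using assms unfolding tensorial_form_def by blast+

lemma tensorial_form_scaleR:
  assumes "tensorial_form \<A> T" "X \<in> vector_fields \<A>" "Y \<in> vector_fields \<A>"
  shows "T (c *\<^sub>R X) Y = (\<lambda>p. c * T X Y p)" "T X (c *\<^sub>R Y) = (\<lambda>p. c * T X Y p)"
  using assms by (simp_all add: scaleR_eq_fun_scale tensorial_formD smooth_functions_const)

lemma tensorial_form_minus:
  assumes "tensorial_form \<A> T" "X \<in> vector_fields \<A>" "Y \<in> vector_fields \<A>"
  shows "T (- X) Y = - T X Y" "T X (- Y) = - T X Y"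
  using tensorial_form_scaleR[OF assms, of "-1"] by (simp_all add: fun_eq_iff)

lemma tensorial_form_diff:
  assumes "tensorial_form \<A> T" "X \<in> vector_fields \<A>" "Y \<in> vector_fields \<A>" "Z \<in> vector_fields \<A>"
  shows "T (X - Y) Z = T X Z - T Y Z" "T X (Y - Z) = T X Y - T X Z"
  using tensorial_formD(2)[OF assms(1,2) vector_fields_minus[OF assms(3)] assms(4)]
    tensorial_formD(3)[OF assms(1,2,3) vector_fields_minus[OF assms(4)]]
    tensorial_form_minus[OF assms(1)] assms by simp_all

lemma tensorial_form_swap: "tensorial_form \<A> T \<Longrightarrow> tensorial_form \<A> (\<lambda>X Y. T Y X)"
  by (simp add: tensorial_form_def)

lemma tensorial_form_add:
  assumes "tensorial_form \<A> S" "tensorial_form \<A> T"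
  shows "tensorial_form \<A> (\<lambda>X Y. S X Y + T X Y)"
proof -
  have "S X Y + T X Y \<in> smooth_functions \<A>" if "X \<in> vector_fields \<A>" "Y \<in> vector_fields \<A>" for X Y
    using assms[THEN tensorial_formD(1), OF that] smooth_functions_add by (simp add: plus_fun_def)
  then show ?thesis
    unfolding tensorial_form_def
    by (simp add: tensorial_formD(2-)[OF assms(1)] tensorial_formD(2-)[OF assms(2)])
      (simp add: fun_eq_iff algebra_simps)
qed

lemma tensorial_form_scale:
  assumes "tensorial_form \<A> T"
  shows "tensorial_form \<A> (\<lambda>X Y. c *\<^sub>R T X Y)"
  unfolding tensorial_form_def
  using assms[THEN tensorial_formD(1)] smooth_functions_scale
  by (auto simp: tensorial_formD(2-)[OF assms(1)] scaleR_fun_def algebra_simps)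

text \<open>Scaling an argument by \<open>h\<close> produces \<open>deriv_along \<xi> h\<close>
  twice, from the product rule in the first term and from the bracket with the scaled field. The two
  contributions cancel.\<close>

lemma tensorial_form_lie_derivative:
  assumes "tensorial_form \<A> T" "\<xi> \<in> vector_fields \<A>"
  shows "tensorial_form \<A> (lie_derivative \<xi> T)"
proof -
  note rules = tensorial_formD[OF assms(1)] vector_fields_lie_bracket[OF assms(2)]
    vector_fields_add vector_fields_fun_scale deriv_along_smooth[OF assms(2)]
    lie_bracket_add_right[OF assms(2)] lie_bracket_fun_scale_right[OF _ assms(2)] lie_derivative_def
  show ?thesis
    unfolding tensorial_form_def
  proof (intro conjI ballI)
    fix X Y assume XY: "X \<in> vector_fields \<A>" "Y \<in> vector_fields \<A>"
    then show "lie_derivative \<xi> T X Y \<in> smooth_functions \<A>"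
      by (simp add: lie_derivative_def fun_diff_def smooth_functions_diff rules(1,6,9))
    fix Z assume "Z \<in> vector_fields \<A>"
    with XY show "lie_derivative \<xi> T (X + Y) Z = lie_derivative \<xi> T X Z + lie_derivative \<xi> T Y Z"
      "lie_derivative \<xi> T X (Y + Z) = lie_derivative \<xi> T X Y + lie_derivative \<xi> T X Z"
      by (simp_all add: rules) (simp_all add: fun_eq_iff plus_fun_def deriv_along_def rules
        tangent_add[OF field_tangent[OF assms(2)]])
  next
    fix h X Y assume "h \<in> smooth_functions \<A>" "X \<in> vector_fields \<A>" "Y \<in> vector_fields \<A>"
    then show "lie_derivative \<xi> T (fun_scale h X) Y = (\<lambda>p. h p * lie_derivative \<xi> T X Y p)"
      "lie_derivative \<xi> T X (fun_scale h Y) = (\<lambda>p. h p * lie_derivative \<xi> T X Y p)"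
      by (simp_all add: rules) (simp_all add: fun_eq_iff deriv_along_def rules
        tangent_mult[OF field_tangent[OF assms(2)]] algebra_simps)
  qed
qed

end

section \<open>Lorentzian frames\<close>

context smooth_manifold
begin

lemma tensorial_form_curvature:
  assumes "tensorial_form \<A> T" "affine_connection \<A> D" "Z \<in> vector_fields \<A>"
  shows "tensorial_form \<A> (\<lambda>X Y. T (curvature D X Z Y) Z)"
  unfolding tensorial_form_def
  using assms by (simp add: curvature_add[OF assms(2)] curvature_fun_scale[OF assms(2)]
      vector_fields_curvature tensorial_formD[OF assms(1)])

lemma tensorial_form_ricci:
  assumes "tensorial_form \<A> (metric_app g)" "affine_connection \<A> D"
    "e1 \<in> vector_fields \<A>" "e2 \<in> vector_fields \<A>" "e3 \<in> vector_fields \<A>"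
  shows "tensorial_form \<A> (ricci g D e1 e2 e3)"
proof -
  \<comment> \<open>Minus signs become multiples by \<open>-1\<close>, so that closure under sums
    and multiples applies to the three traced terms.\<close>
  have "ricci g D e1 e2 e3 = (\<lambda>X Y. (-1) *\<^sub>R metric_app g (curvature D X e1 Y) e1 +
      (-1) *\<^sub>R metric_app g (curvature D X e2 Y) e2 + metric_app g (curvature D X e3 Y) e3)"
    by (intro ext) (simp add: ricci_def)
  then show ?thesis
    by (simp only: tensorial_form_add tensorial_form_scale tensorial_form_curvature assms)
qed

lemma tensorial_form_sym_ricci:
  assumes "tensorial_form \<A> (metric_app g)" "affine_connection \<A> D"
    "e1 \<in> vector_fields \<A>" "e2 \<in> vector_fields \<A>" "e3 \<in> vector_fields \<A>"
  shows "tensorial_form \<A> (sym_ricci g D e1 e2 e3)"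
  unfolding sym_ricci_def[abs_def]
  by (intro tensorial_form_scale tensorial_form_add tensorial_form_swap[of "ricci g D e1 e2 e3"]
      tensorial_form_ricci assms)

end

locale lorentzian_frame = smooth_manifold \<A>
  for \<A> :: "('m::topological_space, 'e::euclidean_space) chart set" +
  fixes g :: "'m metric" and e1 e2 e3 :: "'m field"
  assumes lorentzian: "lorentzian_metric \<A> g"
    and frame_fields: "e1 \<in> vector_fields \<A>" "e2 \<in> vector_fields \<A>" "e3 \<in> vector_fields \<A>"
    and orthonormal: "pseudo_orthonormal g e1 e2 e3"
begin

lemma metric_sym_at: "\<lbrakk>u \<in> tangent_space \<A> p; v \<in> tangent_space \<A> p\<rbrakk> \<Longrightarrow> g p u v = g p v u"
  using lorentzian unfolding lorentzian_metric_def by blast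

lemma metric_linear_at:
  "\<lbrakk>u \<in> tangent_space \<A> p; v \<in> tangent_space \<A> p; w \<in> tangent_space \<A> p\<rbrakk> \<Longrightarrow>
    g p (a *\<^sub>R u + b *\<^sub>R v) w = a * g p u w + b * g p v w"
  using lorentzian unfolding lorentzian_metric_def by blast

lemma metric_sym:
  "X \<in> vector_fields \<A> \<Longrightarrow> Y \<in> vector_fields \<A> \<Longrightarrow> metric_app g X Y = metric_app g Y X"
  by (simp add: metric_app_def fun_eq_iff metric_sym_at field_tangent)

lemma tensorial_metric: "tensorial_form \<A> (metric_app g)"
proof -
  have add: "metric_app g (X + Y) Z = metric_app g X Z + metric_app g Y Z"
    if "X \<in> vector_fields \<A>" "Y \<in> vector_fields \<A>" "Z \<in> vector_fields \<A>" for X Y Z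
    using that metric_linear_at[OF that[THEN field_tangent], of _ 1 1]
    by (simp add: metric_app_def fun_eq_iff)
  have scale: "metric_app g (fun_scale h X) Z = (\<lambda>p. h p * metric_app g X Z p)"
    if "X \<in> vector_fields \<A>" "Z \<in> vector_fields \<A>" for h X Z
    using that metric_linear_at[OF that(1,1,2)[THEN field_tangent], of _ _ 0]
    by (simp add: metric_app_def fun_scale_def)
  show ?thesis
    unfolding tensorial_form_def
  proof (intro conjI ballI)
    fix X Y assume XY: "X \<in> vector_fields \<A>" "Y \<in> vector_fields \<A>"
    then show "metric_app g X Y \<in> smooth_functions \<A>"
      using lorentzian unfolding lorentzian_metric_def by blast
    fix Z assume Z: "Z \<in> vector_fields \<A>"
    show "metric_app g (X + Y) Z = metric_app g X Z + metric_app g Y Z"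
      by (rule add[OF XY Z])
    show "metric_app g X (Y + Z) = metric_app g X Y + metric_app g X Z"
      using add[OF XY(2) Z XY(1)] XY Z by (simp add: metric_sym[of X] vector_fields_add)
  next
    fix h X Y assume *: "h \<in> smooth_functions \<A>" "X \<in> vector_fields \<A>" "Y \<in> vector_fields \<A>"
    show "metric_app g (fun_scale h X) Y = (\<lambda>p. h p * metric_app g X Y p)"
      by (rule scale[OF *(2,3)])
    show "metric_app g X (fun_scale h Y) = (\<lambda>p. h p * metric_app g X Y p)"
      using scale[OF *(3,2), of h] * by (simp add: metric_sym[of X] vector_fields_fun_scale)
  qed
qed

lemma metric_frame:
  "metric_app g e1 e1 = (\<lambda>p. 1)" "metric_app g e2 e2 = (\<lambda>p. 1)" "metric_app g e3 e3 = (\<lambda>p. -1)"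
  "metric_app g e1 e2 = (\<lambda>p. 0)" "metric_app g e1 e3 = (\<lambda>p. 0)" "metric_app g e2 e3 = (\<lambda>p. 0)"
  "metric_app g e2 e1 = (\<lambda>p. 0)" "metric_app g e3 e1 = (\<lambda>p. 0)" "metric_app g e3 e2 = (\<lambda>p. 0)"
  using orthonormal metric_sym[OF frame_fields(2,1)] metric_sym[OF frame_fields(3,1)]
    metric_sym[OF frame_fields(3,2)]
  by (simp_all add: pseudo_orthonormal_def)

text \<open>Pairing with the frame reads off coefficients, with a sign for the timelike
  \<open>e3\<close>. This yields both the independence of the frame and the expansion of
  fields.\<close>

lemma metric_combination_at:
  fixes p
  defines "v \<equiv> (\<lambda>a b c. a *\<^sub>R e1 p + b *\<^sub>R e2 p + c *\<^sub>R e3 p)"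
  shows "g p (v a b c) (e1 p) = a" "g p (v a b c) (e2 p) = b" "g p (v a b c) (e3 p) = - c"
proof -
  note tangent = frame_fields[THEN field_tangent, of p]
  have "g p (v a b c) w = a * g p (e1 p) w + b * g p (e2 p) w + c * g p (e3 p) w"
    if "w \<in> tangent_space \<A> p" for w
  proof -
    have "a *\<^sub>R e1 p + b *\<^sub>R e2 p \<in> tangent_space \<A> p"
      using subspace_tangent_space tangent by (intro subspace_add subspace_scale)
    from metric_linear_at[OF this tangent(3) that, of 1 c] show ?thesis
      by (simp add: v_def metric_linear_at[OF tangent(1,2) that])
  qed
  then show "g p (v a b c) (e1 p) = a" "g p (v a b c) (e2 p) = b" "g p (v a b c) (e3 p) = - c"
    using metric_frame[unfolded metric_app_def fun_eq_iff] tangent by simp_all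
qed

text \<open>Pairings make the frame vectors independent, and \<open>lorentzian_metric\<close>
  supplies a spanning set of at most three vectors. A tangent vector outside the span of the frame
  would give four independent vectors there.\<close>

lemma tangent_space_frame: "tangent_space \<A> p = span {e1 p, e2 p, e3 p}"
proof
  note comb = metric_combination_at[of p]
  have distinct: "e1 p \<noteq> e2 p" "e1 p \<noteq> e3 p" "e2 p \<noteq> e3 p"
    using comb[of 1 0 0] comb[of 0 1 0] comb[of 0 0 1] by auto
  have "e1 p \<notin> span {e2 p, e3 p}"
  proof
    assume "e1 p \<in> span {e2 p, e3 p}"
    \<comment> \<open>The padding with coefficient zero brings the relation into the form of
      \<open>comb\<close>; pairing with \<open>e1 p\<close> then gives both zero and one.\<close>
    then obtain b c where "e1 p = 0 *\<^sub>R e1 p + b *\<^sub>R e2 p + c *\<^sub>R e3 p"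
      unfolding span_insert span_empty by (auto simp: algebra_simps)
    then show False
      using comb(1)[of 0 b c] comb(1)[of 1 0 0] by simp
  qed
  moreover have "e2 p \<notin> span {e3 p}"
  proof
    assume "e2 p \<in> span {e3 p}"
    then obtain c where "e2 p = 0 *\<^sub>R e1 p + 0 *\<^sub>R e2 p + c *\<^sub>R e3 p"
      unfolding span_insert span_empty by auto
    then show False
      using comb(2)[of 0 0 c] comb(2)[of 0 1 0] by simp
  qed
  moreover have "e3 p \<noteq> 0"
    using comb(3)[of 0 0 0] comb(3)[of 0 0 1] by auto
  ultimately have indep: "independent {e1 p, e2 p, e3 p}"
    by (simp add: independent_insert)
  obtain u v w where uvw: "span {u, v, w} = tangent_space \<A> p"
    using lorentzian unfolding lorentzian_metric_def by metis
  show "tangent_space \<A> p \<subseteq> span {e1 p, e2 p, e3 p}"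
  proof
    fix x assume x: "x \<in> tangent_space \<A> p"
    show "x \<in> span {e1 p, e2 p, e3 p}"
    proof (rule ccontr)
      assume notin: "x \<notin> span {e1 p, e2 p, e3 p}"
      have "insert x {e1 p, e2 p, e3 p} \<subseteq> span {u, v, w}"
        using x frame_fields[THEN field_tangent, of p] by (simp add: uvw)
      then have "card (insert x {e1 p, e2 p, e3 p}) \<le> card {u, v, w}"
        by (intro independent_span_bound[THEN conjunct2] independent_insertI notin indep) simp
      also have "card {u, v, w} \<le> 3"
        by (simp add: card_insert_if)
      ultimately show False
        using notin distinct span_superset[of "{e1 p, e2 p, e3 p}"] by (auto simp: card_insert_if split: if_splits)
    qed
  qed
  show "span {e1 p, e2 p, e3 p} \<subseteq> tangent_space \<A> p"
    using frame_fields[THEN field_tangent] by (intro span_minimal subspace_tangent_space) auto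
qed

lemma frame_expansion:
  assumes "X \<in> vector_fields \<A>"
  shows "X = fun_scale (metric_app g X e1) e1 + fun_scale (metric_app g X e2) e2 +
    fun_scale (\<lambda>p. - metric_app g X e3 p) e3"
proof
  fix p
  obtain a b c where X: "X p = a *\<^sub>R e1 p + b *\<^sub>R e2 p + c *\<^sub>R e3 p"
    using field_tangent[OF assms, of p] unfolding tangent_space_frame span_insert span_empty
    by (auto simp: algebra_simps)
  show "X p = (fun_scale (metric_app g X e1) e1 + fun_scale (metric_app g X e2) e2 +
    fun_scale (\<lambda>p. - metric_app g X e3 p) e3) p"
    by (simp add: fun_scale_def metric_app_def X metric_combination_at)
qed

text \<open>By \<open>frame_expansion\<close> both arguments are combinations of the frame with
  smooth coefficient functions, which can be pulled out of a tensorial form.\<close>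

lemma tensorial_form_eq_zero:
  assumes "tensorial_form \<A> T" "X \<in> vector_fields \<A>" "Y \<in> vector_fields \<A>"
    "\<And>V W. V \<in> {e1, e2, e3} \<Longrightarrow> W \<in> {e1, e2, e3} \<Longrightarrow> T V W = (\<lambda>p. 0)"
  shows "T X Y = (\<lambda>p. 0)"
proof -
  note T = tensorial_formD[OF assms(1)]
  have smooth: "metric_app g Z W \<in> smooth_functions \<A>" "(\<lambda>p. - metric_app g Z W p) \<in> smooth_functions \<A>"
    if "Z \<in> vector_fields \<A>" "W \<in> vector_fields \<A>" for Z W
    using tensorial_formD(1)[OF tensorial_metric that] smooth_functions_scale[of _ "-1"] by auto
  have "T V Y = (\<lambda>p. 0)" if V: "V \<in> {e1, e2, e3}" for V
  proof -
    have "V \<in> vector_fields \<A>"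
      using V frame_fields by blast
    then show ?thesis
      using frame_fields by (subst frame_expansion[OF assms(3)],
        simp add: T smooth assms(3) assms(4)[OF V] vector_fields_add vector_fields_fun_scale,
        simp add: fun_eq_iff)
  qed
  then show ?thesis
    using frame_fields by (subst frame_expansion[OF assms(2)],
      simp add: T smooth assms(2,3) vector_fields_add vector_fields_fun_scale,
      simp add: fun_eq_iff)
qed

section \<open>Fields with constant coefficients in the frame\<close>

definition frame_comb :: "real \<Rightarrow> real \<Rightarrow> real \<Rightarrow> 'm field"
  where "frame_comb a b c = a *\<^sub>R e1 + b *\<^sub>R e2 + c *\<^sub>R e3"

lemma frame_eq_comb: "e1 = frame_comb 1 0 0" "e2 = frame_comb 0 1 0" "e3 = frame_comb 0 0 1"
  by (simp_all add: frame_comb_def)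

lemma vector_fields_frame_comb: "frame_comb a b c \<in> vector_fields \<A>"
  by (simp add: frame_comb_def vector_fields_add vector_fields_scaleR frame_fields)

lemma frame_comb_arith:
  "frame_comb a b c + frame_comb x y z = frame_comb (a + x) (b + y) (c + z)"
  "frame_comb a b c - frame_comb x y z = frame_comb (a - x) (b - y) (c - z)"
  "r *\<^sub>R frame_comb a b c = frame_comb (r * a) (r * b) (r * c)"
  "- frame_comb a b c = frame_comb (- a) (- b) (- c)"
  by (simp_all add: frame_comb_def algebra_simps)

lemma metric_frame_comb:
  "metric_app g (frame_comb a b c) (frame_comb x y z) = (\<lambda>p. a * x + b * y - c * z)"
  by (simp add: frame_comb_def tensorial_formD[OF tensorial_metric] frame_fields vector_fields_add
      vector_fields_scaleR tensorial_form_scaleR[OF tensorial_metric] metric_frame fun_eq_iff)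

lemma frame_comb_eq_iff: "frame_comb a b c = frame_comb x y z \<longleftrightarrow> a = x \<and> b = y \<and> c = z"
proof
  assume eq: "frame_comb a b c = frame_comb x y z"
  have "metric_app g (frame_comb a b c) W p = metric_app g (frame_comb x y z) W p" for W p
    using eq by simp
  from this[of "frame_comb 1 0 0"] this[of "frame_comb 0 1 0"] this[of "frame_comb 0 0 1"]
  show "a = x \<and> b = y \<and> c = z"
    by (simp add: metric_frame_comb)
qed simp

text \<open>Constant coefficients have derivative zero, so the Leibniz terms vanish and nine values
  on the frame determine the connection.\<close>

lemma connection_frame_comb:
  assumes "affine_connection \<A> D"
  shows "D (frame_comb a b c) (frame_comb x y z) =
    (a * x) *\<^sub>R D e1 e1 + (a * y) *\<^sub>R D e1 e2 + (a * z) *\<^sub>R D e1 e3 +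
    (b * x) *\<^sub>R D e2 e1 + (b * y) *\<^sub>R D e2 e2 + (b * z) *\<^sub>R D e2 e3 +
    (c * x) *\<^sub>R D e3 e1 + (c * y) *\<^sub>R D e3 e2 + (c * z) *\<^sub>R D e3 e3"
  by (simp add: frame_comb_def affine_connection_rules[OF assms] frame_fields vector_fields_add
      vector_fields_scaleR affine_connection_scaleR[OF assms] algebra_simps)

lemma field_eq_frame_comb:
  assumes "X \<in> vector_fields \<A>" "metric_app g X e1 = (\<lambda>p. a)" "metric_app g X e2 = (\<lambda>p. b)"
    "metric_app g X e3 = (\<lambda>p. - c)"
  shows "X = frame_comb a b c"
  using frame_expansion[OF assms(1)] assms(2-)
  by (simp add: frame_comb_def scaleR_eq_fun_scale)

text \<open>Puts left-invariant fields into coordinates: the final theorem assumes that they are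
  exactly this span.\<close>

lemma span_frame: "span {e1, e2, e3} = {frame_comb a b c | a b c. True}"
proof (intro equalityI subsetI)
  fix X assume "X \<in> span {e1, e2, e3}"
  then show "X \<in> {frame_comb a b c | a b c. True}"
    unfolding span_insert span_empty frame_comb_def by (force simp: algebra_simps)
next
  fix X assume "X \<in> {frame_comb a b c | a b c. True}"
  then show "X \<in> span {e1, e2, e3}"
    unfolding frame_comb_def by (auto intro!: span_add span_scale intro: span_base)
qed

lemma span_singleton_frame_comb: "span {frame_comb a b c} = {frame_comb (k * a) (k * b) (k * c) | k. True}"
  by (auto simp: span_singleton frame_comb_arith)

lemma frame_comb_eq_zero_iff: "frame_comb a b c = 0 \<longleftrightarrow> a = 0 \<and> b = 0 \<and> c = 0"
  using frame_comb_eq_iff[of a b c 0 0 0] by (simp add: frame_comb_def)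

end

section \<open>The Lie group \<open>G\<^sub>2\<close>\<close>

locale g2_frame = lorentzian_frame \<A> g e1 e2 e3
  for \<A> :: "('m::topological_space, 'e::euclidean_space) chart set"
    and g :: "'m metric" and e1 e2 e3 :: "'m field" +
  fixes J :: "'m endo" and D :: "'m connection" and \<alpha> \<beta> \<gamma> :: real
  assumes levi_civita: "levi_civita_connection \<A> g D"
    and endomorphism: "endomorphism_field \<A> J"
    and brackets: "lie_bracket e1 e2 = \<gamma> *\<^sub>R e2 - \<beta> *\<^sub>R e3"
      "lie_bracket e1 e3 = - (\<beta> *\<^sub>R e2) - \<gamma> *\<^sub>R e3"
      "lie_bracket e2 e3 = \<alpha> *\<^sub>R e1"
    and J_frame: "endo_app J e1 = e1" "endo_app J e2 = e2" "endo_app J e3 = - e3"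
begin

lemma affine: "affine_connection \<A> D"
  using levi_civita by (simp add: levi_civita_connection_def)

lemma torsion_free:
  "X \<in> vector_fields \<A> \<Longrightarrow> Y \<in> vector_fields \<A> \<Longrightarrow> D X Y - D Y X = lie_bracket X Y"
  using levi_civita by (simp add: levi_civita_connection_def)

text \<open>The constants \<open>g (D e\<^sub>i e\<^sub>j, e\<^sub>k)\<close> solve the linear system expressing that \<open>D\<close> is metric
  and torsion-free (Koszul).\<close>

lemma levi_civita_frame:
  "D e1 e1 = frame_comb 0 0 0"
  "D e1 e2 = frame_comb 0 0 (\<alpha> / 2 - \<beta>)"
  "D e1 e3 = frame_comb 0 (\<alpha> / 2 - \<beta>) 0"
  "D e2 e1 = frame_comb 0 (- \<gamma>) (\<alpha> / 2)"
  "D e2 e2 = frame_comb \<gamma> 0 0"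
  "D e2 e3 = frame_comb (\<alpha> / 2) 0 0"
  "D e3 e1 = frame_comb 0 (\<alpha> / 2) \<gamma>"
  "D e3 e2 = frame_comb (- (\<alpha> / 2)) 0 0"
  "D e3 e3 = frame_comb \<gamma> 0 0"
proof -
  \<comment> \<open>Pairings of frame fields are constant, so metric compatibility says that
    \<open>D X\<close> is skew for the metric on the frame.\<close>
  have metric: "metric_app g (D X Y) Z p + metric_app g (D X Z) Y p = 0"
    if "X \<in> {e1, e2, e3}" "Y \<in> {e1, e2, e3}" "Z \<in> {e1, e2, e3}" for X Y Z p
  proof -
    have XYZ: "X \<in> vector_fields \<A>" "Y \<in> vector_fields \<A>" "Z \<in> vector_fields \<A>"
      using that frame_fields by blast+
    have "\<exists>c. metric_app g Y Z = (\<lambda>p. c)"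
      using that(2,3) metric_frame by blast
    then have "deriv_along X (metric_app g Y Z) = (\<lambda>p. 0)"
      using deriv_along_const[OF XYZ(1)] by force
    moreover have "deriv_along X (metric_app g Y Z) = metric_app g (D X Y) Z + metric_app g Y (D X Z)"
      using levi_civita XYZ unfolding levi_civita_connection_def by blast
    moreover have "metric_app g Y (D X Z) = metric_app g (D X Z) Y"
      using XYZ by (simp add: metric_sym affine_connection_rules[OF affine])
    ultimately show ?thesis
      by (simp add: fun_eq_iff)
  qed
  have torsion: "metric_app g (D X Y) Z p - metric_app g (D Y X) Z p = metric_app g (lie_bracket X Y) Z p"
    if "X \<in> vector_fields \<A>" "Y \<in> vector_fields \<A>" "Z \<in> vector_fields \<A>" for X Y Z p
    using that by (simp add: torsion_free[symmetric] tensorial_form_diff[OF tensorial_metric]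
        affine_connection_rules[OF affine])
  have bracket_metric:
    "metric_app g (lie_bracket e1 e2) e1 p = 0" "metric_app g (lie_bracket e1 e2) e2 p = \<gamma>"
    "metric_app g (lie_bracket e1 e2) e3 p = \<beta>" "metric_app g (lie_bracket e1 e3) e1 p = 0"
    "metric_app g (lie_bracket e1 e3) e2 p = - \<beta>" "metric_app g (lie_bracket e1 e3) e3 p = \<gamma>"
    "metric_app g (lie_bracket e2 e3) e1 p = \<alpha>" "metric_app g (lie_bracket e2 e3) e2 p = 0"
    "metric_app g (lie_bracket e2 e3) e3 p = 0" for p
    by (simp_all add: brackets tensorial_form_diff[OF tensorial_metric] tensorial_form_minus[OF tensorial_metric]
        tensorial_form_scaleR[OF tensorial_metric] frame_fields vector_fields_scaleR vector_fields_minus metric_frame)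
  have metric_all: "metric_app g (D X e1) e1 p = 0" "metric_app g (D X e2) e2 p = 0"
    "metric_app g (D X e3) e3 p = 0"
    "metric_app g (D X e2) e1 p = - metric_app g (D X e1) e2 p"
    "metric_app g (D X e3) e1 p = - metric_app g (D X e1) e3 p"
    "metric_app g (D X e3) e2 p = - metric_app g (D X e2) e3 p" if "X \<in> {e1, e2, e3}" for X p
    using metric[OF that, of e1 e1 p] metric[OF that, of e2 e2 p] metric[OF that, of e3 e3 p]
      metric[OF that, of e1 e2 p] metric[OF that, of e1 e3 p] metric[OF that, of e2 e3 p]
    by simp_all
  have frame_mem: "e1 \<in> {e1, e2, e3}" "e2 \<in> {e1, e2, e3}" "e3 \<in> {e1, e2, e3}"
    by simp_all
  \<comment> \<open>Skewness leaves three unknown pairings in each of the three directions, and the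
    nine torsion identities determine them. Pairings with \<open>e3\<close> are the negatives of the
    coefficients in the table.\<close>
  have coefficients:
    "metric_app g (D e1 e1) e2 p = 0 \<and> metric_app g (D e1 e1) e3 p = 0 \<and>
     metric_app g (D e1 e2) e3 p = \<beta> - \<alpha> / 2 \<and>
     metric_app g (D e2 e1) e2 p = - \<gamma> \<and> metric_app g (D e2 e1) e3 p = - (\<alpha> / 2) \<and>
     metric_app g (D e2 e2) e3 p = 0 \<and>
     metric_app g (D e3 e1) e2 p = \<alpha> / 2 \<and> metric_app g (D e3 e1) e3 p = - \<gamma> \<and>
     metric_app g (D e3 e2) e3 p = 0" for p
    using metric_all[OF frame_mem(1), of p] metric_all[OF frame_mem(2), of p]
      metric_all[OF frame_mem(3), of p] bracket_metric[of p]
      torsion[OF frame_fields(1,2,1), of p] torsion[OF frame_fields(1,2,2), of p]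
      torsion[OF frame_fields(1,2,3), of p] torsion[OF frame_fields(1,3,1), of p]
      torsion[OF frame_fields(1,3,2), of p] torsion[OF frame_fields(1,3,3), of p]
      torsion[OF frame_fields(2,3,1), of p] torsion[OF frame_fields(2,3,2), of p]
      torsion[OF frame_fields(2,3,3), of p]
    by (intro conjI; linarith)
  note DX = affine_connection_rules(1)[OF affine]
  show
    "D e1 e1 = frame_comb 0 0 0"
    "D e1 e2 = frame_comb 0 0 (\<alpha> / 2 - \<beta>)"
    "D e1 e3 = frame_comb 0 (\<alpha> / 2 - \<beta>) 0"
    "D e2 e1 = frame_comb 0 (- \<gamma>) (\<alpha> / 2)"
    "D e2 e2 = frame_comb \<gamma> 0 0"
    "D e2 e3 = frame_comb (\<alpha> / 2) 0 0"
    "D e3 e1 = frame_comb 0 (\<alpha> / 2) \<gamma>"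
    "D e3 e2 = frame_comb (- (\<alpha> / 2)) 0 0"
    "D e3 e3 = frame_comb \<gamma> 0 0"
    by (rule field_eq_frame_comb; simp add: DX frame_fields fun_eq_iff metric_all[OF frame_mem(1)]
        metric_all[OF frame_mem(2)] metric_all[OF frame_mem(3)] coefficients)+
qed

section \<open>Connections, bracket and Ricci tensor in frame coordinates\<close>

abbreviation "D1 \<equiv> kobayashi_nomizu_connection D J"

lemma levi_civita_comb:
  "D (frame_comb a b c) (frame_comb x y z) = frame_comb
    (\<gamma> * b * y + \<alpha> / 2 * b * z - \<alpha> / 2 * c * y + \<gamma> * c * z)
    ((\<alpha> / 2 - \<beta>) * a * z - \<gamma> * b * x + \<alpha> / 2 * c * x)
    ((\<alpha> / 2 - \<beta>) * a * y + \<alpha> / 2 * b * x + \<gamma> * c * x)"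
  unfolding connection_frame_comb[OF affine] levi_civita_frame frame_comb_arith frame_comb_eq_iff
  by (simp add: algebra_simps)

text \<open>Torsion-freeness reads the bracket off the formula for \<open>D\<close>, which spares a
  second bilinear expansion.\<close>

lemma lie_bracket_comb:
  "lie_bracket (frame_comb a b c) (frame_comb x y z) = frame_comb
    (\<alpha> * (b * z - c * y))
    (\<gamma> * (a * y - b * x) - \<beta> * (a * z - c * x))
    (- \<beta> * (a * y - b * x) - \<gamma> * (a * z - c * x))"
  unfolding torsion_free[OF vector_fields_frame_comb vector_fields_frame_comb, symmetric]
    levi_civita_comb frame_comb_arith frame_comb_eq_iff
  by (simp add: algebra_simps)

lemma J_comb: "endo_app J (frame_comb a b c) = frame_comb a b (- c)"
  by (simp add: frame_comb_def endo_app_rules[OF endomorphism] vector_fields_add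
      vector_fields_scaleR frame_fields scaleR_eq_fun_scale vector_fields_fun_scale smooth_functions_const J_frame)
    (simp add: fun_eq_iff field_apply)

text \<open>The first two components involve \<open>z\<close> nowhere and the third contains neither
  \<open>x\<close> nor \<open>y\<close>: the connection preserves the eigenspaces of
  \<open>J\<close>, the plane of \<open>e1\<close> and \<open>e2\<close> and the line of
  \<open>e3\<close>.\<close>

lemma kobayashi_nomizu_comb:
  "D1 (frame_comb a b c) (frame_comb x y z) = frame_comb
    (\<gamma> * b * y - \<alpha> * c * y) (\<beta> * c * x - \<gamma> * b * x) (- \<gamma> * a * z)"
  unfolding kobayashi_nomizu_connection_def canonical_connection_def deriv_endo_def J_comb
    levi_civita_comb frame_comb_arith frame_comb_eq_iff
  by (simp add: field_simps)

lemma affine_D1: "affine_connection \<A> D1"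
  by (rule affine_connection_kobayashi_nomizu[OF affine endomorphism])

lemma ricci_comb:
  "ricci g D1 e1 e2 e3 (frame_comb a b c) (frame_comb x y z) =
    (\<lambda>p. - (\<beta>\<^sup>2 + \<gamma>\<^sup>2) * a * x - (\<alpha> * \<beta> + \<gamma>\<^sup>2) * b * y - \<alpha> * \<gamma> * b * z)"
proof -
  have "curvature D1 (frame_comb a b c) (frame_comb l m n) (frame_comb x y z) =
    D1 (frame_comb a b c) (D1 (frame_comb l m n) (frame_comb x y z)) -
    D1 (frame_comb l m n) (D1 (frame_comb a b c) (frame_comb x y z)) -
    D1 (lie_bracket (frame_comb a b c) (frame_comb l m n)) (frame_comb x y z)" for l m n
    by (rule curvature_def)
  note curv = this[unfolded kobayashi_nomizu_comb lie_bracket_comb frame_comb_arith]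
  \<comment> \<open>With the traced frame written as \<open>frame_comb\<close>, every field in the
    curvature is a constant combination and the coordinate formulas evaluate it.\<close>
  have "ricci g D1 (frame_comb 1 0 0) (frame_comb 0 1 0) (frame_comb 0 0 1) (frame_comb a b c) (frame_comb x y z) =
    (\<lambda>p. - (\<beta>\<^sup>2 + \<gamma>\<^sup>2) * a * x - (\<alpha> * \<beta> + \<gamma>\<^sup>2) * b * y - \<alpha> * \<gamma> * b * z)"
    unfolding ricci_def curv metric_frame_comb
    by (simp add: fun_eq_iff power2_eq_square algebra_simps)
  then show ?thesis
    unfolding frame_eq_comb[symmetric] .
qed

text \<open>\<open>ricci\<close> has a term in \<open>b * z\<close> but none in
  \<open>c * y\<close>; symmetrization splits it equally between the two.\<close>

lemma sym_ricci_comb: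
  "sym_ricci g D1 e1 e2 e3 (frame_comb a b c) (frame_comb x y z) =
    (\<lambda>p. - (\<beta>\<^sup>2 + \<gamma>\<^sup>2) * a * x - (\<alpha> * \<beta> + \<gamma>\<^sup>2) * b * y - \<alpha> * \<gamma> / 2 * (b * z + c * y))"
  by (simp add: sym_ricci_def ricci_comb fun_eq_iff scaleR_fun_apply field_simps)

text \<open>The tensor is constant on constant combinations, so only the bracket terms survive. The
  entry at \<open>e1\<close>, \<open>e1\<close> vanishes identically, which leaves five
  coefficients.\<close>

lemma lie_derivative_comb:
  "lie_derivative (frame_comb a b c) (sym_ricci g D1 e1 e2 e3) (frame_comb x y z) (frame_comb u v w) =
    (\<lambda>p. (\<gamma>\<^sup>2 * (\<beta> - \<alpha> / 2) * c - (\<alpha> * \<beta> / 2 + \<gamma>\<^sup>2) * \<gamma> * b) * (x * v + y * u) +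
      \<alpha> * ((\<beta>\<^sup>2 + \<gamma>\<^sup>2 / 2) * b + \<beta> * \<gamma> / 2 * c) * (x * w + z * u) +
      (\<alpha> * \<beta> + 2 * \<gamma>\<^sup>2) * \<gamma> * a * (y * v) - (\<alpha> * \<beta> + \<gamma>\<^sup>2) * \<beta> * a * (y * w + z * v) -
      \<alpha> * \<beta> * \<gamma> * a * (z * w))"
  unfolding lie_derivative_def lie_bracket_comb sym_ricci_comb deriv_along_const[OF vector_fields_frame_comb]
  by (simp add: fun_eq_iff power2_eq_square field_simps)

section \<open>The linear equations for collineations and their solution\<close>

lemma collineation_iff_equations:
  "(\<forall>X\<in>vector_fields \<A>. \<forall>Y\<in>vector_fields \<A>.
      lie_derivative (frame_comb a b c) (sym_ricci g D1 e1 e2 e3) X Y = (\<lambda>p. 0)) \<longleftrightarrow>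
    \<gamma>\<^sup>2 * (\<beta> - \<alpha> / 2) * c - (\<alpha> * \<beta> / 2 + \<gamma>\<^sup>2) * \<gamma> * b = 0 \<and>
    \<alpha> * ((\<beta>\<^sup>2 + \<gamma>\<^sup>2 / 2) * b + \<beta> * \<gamma> / 2 * c) = 0 \<and>
    (\<alpha> * \<beta> + 2 * \<gamma>\<^sup>2) * \<gamma> * a = 0 \<and> (\<alpha> * \<beta> + \<gamma>\<^sup>2) * \<beta> * a = 0 \<and> \<alpha> * \<beta> * \<gamma> * a = 0"
  (is "?L \<longleftrightarrow> ?R")
proof
  assume ?L
  then have L: "lie_derivative (frame_comb a b c) (sym_ricci g D1 e1 e2 e3) (frame_comb x y z) (frame_comb u v w) p
      = 0" for x y z u v w p
    using vector_fields_frame_comb by simp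
  show ?R
    \<comment> \<open>The frame pairs 12, 13, 22, 23 and 33 each isolate one of the five
      coefficients.\<close>
    using L[of 1 0 0 0 1 0] L[of 1 0 0 0 0 1] L[of 0 1 0 0 1 0] L[of 0 1 0 0 0 1] L[of 0 0 1 0 0 1]
    unfolding lie_derivative_comb by simp
next
  assume R: ?R
  have tensorial: "tensorial_form \<A> (lie_derivative (frame_comb a b c) (sym_ricci g D1 e1 e2 e3))"
    by (rule tensorial_form_lie_derivative[OF
        tensorial_form_sym_ricci[OF tensorial_metric affine_D1 frame_fields] vector_fields_frame_comb])
  have "lie_derivative (frame_comb a b c) (sym_ricci g D1 e1 e2 e3) V W = (\<lambda>p. 0)"
    if VW: "V \<in> {e1, e2, e3}" "W \<in> {e1, e2, e3}" for V W
  proof -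
    obtain x y z u v w where *: "V = frame_comb x y z" "W = frame_comb u v w"
      using VW frame_eq_comb by blast
    show ?thesis
      using R unfolding * lie_derivative_comb
      by (elim conjE) (simp only: mult_zero_left add_0_left diff_zero)
  qed
  from tensorial_form_eq_zero[OF tensorial _ _ this] show ?L
    by (intro ballI)
qed

text \<open>The last alternative is the zero field, the only solution for the remaining parameters.
  The first one includes \<beta> = 0, where it means \<open>b = 0\<close> with \<open>c\<close> free
  because \<gamma> \<noteq> 0.\<close>

lemma collineation_iff:
  assumes "\<gamma> \<noteq> 0"
  shows "(\<forall>X\<in>vector_fields \<A>. \<forall>Y\<in>vector_fields \<A>.
      lie_derivative (frame_comb a b c) (sym_ricci g D1 e1 e2 e3) X Y = (\<lambda>p. 0)) \<longleftrightarrow>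
    a = 0 \<and> (\<alpha> = 0 \<and> \<beta> * c = \<gamma> * b \<or>
      \<alpha> \<noteq> 0 \<and> \<beta> \<noteq> 0 \<and> \<alpha> = 4 * \<beta> \<and> c = - (2 * \<beta>\<^sup>2 + \<gamma>\<^sup>2) / (\<beta> * \<gamma>) * b \<or> b = 0 \<and> c = 0)"
  (is "?L \<longleftrightarrow> ?R")
proof
  assume ?L
  then have R: "\<gamma>\<^sup>2 * (\<beta> - \<alpha> / 2) * c - (\<alpha> * \<beta> / 2 + \<gamma>\<^sup>2) * \<gamma> * b = 0"
    "\<alpha> * ((\<beta>\<^sup>2 + \<gamma>\<^sup>2 / 2) * b + \<beta> * \<gamma> / 2 * c) = 0"
    "(\<alpha> * \<beta> + 2 * \<gamma>\<^sup>2) * \<gamma> * a = 0" "\<alpha> * \<beta> * \<gamma> * a = 0"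
    unfolding collineation_iff_equations by blast+
  \<comment> \<open>Difference of the third and fourth equations in \<open>R\<close>.\<close>
  have "2 * \<gamma> ^ 3 * a = 0"
    using R(3,4) by algebra
  then have a: "a = 0"
    using assms by simp
  have "\<gamma> * (\<gamma> * (\<beta> - \<alpha> / 2) * c - (\<alpha> * \<beta> / 2 + \<gamma>\<^sup>2) * b) = 0"
    using R(1) by (simp add: algebra_simps power2_eq_square)
  then have R1: "\<gamma> * (\<beta> - \<alpha> / 2) * c = (\<alpha> * \<beta> / 2 + \<gamma>\<^sup>2) * b"
    using assms by simp
  consider "\<alpha> = 0" | "\<alpha> \<noteq> 0" "\<beta> = 0" | "\<alpha> \<noteq> 0" "\<beta> \<noteq> 0" by blast
  then show ?R
  proof cases
    case 1
    then have "\<gamma> * (\<beta> * c - \<gamma> * b) = 0"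
      using R1 by (simp add: algebra_simps power2_eq_square)
    then show ?thesis
      using 1 assms a by simp
  next
    case 2
    \<comment> \<open>With \<beta> = 0 the second equation gives \<open>b = 0\<close>, and then
      \<open>R1\<close> gives \<open>c = 0\<close>.\<close>
    then show ?thesis
      using R(2) R1 assms a by simp
  next
    case 3
    have R2: "\<beta> * \<gamma> * c = - (2 * \<beta>\<^sup>2 + \<gamma>\<^sup>2) * b"
      using R(2) 3 by algebra
    then have c: "c = - (2 * \<beta>\<^sup>2 + \<gamma>\<^sup>2) / (\<beta> * \<gamma>) * b"
      using 3 assms by (simp add: field_simps)
    \<comment> \<open>Multiplying \<open>R1\<close> by \<open>2 * \<beta>\<close> and replacing
      \<open>\<beta> * \<gamma> * c\<close> by means of \<open>R2\<close> eliminates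
      \<open>c\<close>.\<close>
    have "(\<beta>\<^sup>2 + \<gamma>\<^sup>2) * (\<alpha> - 4 * \<beta>) * b = 0"
      using R1 R2 by algebra
    moreover have "\<beta>\<^sup>2 + \<gamma>\<^sup>2 \<noteq> 0"
      using assms by (simp add: sum_power2_eq_zero_iff)
    ultimately show ?thesis
      using a c 3 by auto
  qed
next
  assume R: ?R
  then show ?L
  proof (elim conjE disjE)
    assume "a = 0" "\<alpha> = 0" "\<beta> * c = \<gamma> * b"
    then show ?L
      unfolding collineation_iff_equations by (simp add: power2_eq_square)
  next
    assume *: "a = 0" "\<alpha> \<noteq> 0" "\<beta> \<noteq> 0" "\<alpha> = 4 * \<beta>" "c = - (2 * \<beta>\<^sup>2 + \<gamma>\<^sup>2) / (\<beta> * \<gamma>) * b"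
    then have zero: "\<beta> * \<gamma> * c + (2 * \<beta>\<^sup>2 + \<gamma>\<^sup>2) * b = 0"
      using assms by (simp add: field_simps)
    \<comment> \<open>For \<alpha> = 4\<beta> the two equations in \<open>b\<close> and
      \<open>c\<close> are multiples of one linear form, so a line of solutions remains.\<close>
    have "\<gamma>\<^sup>2 * (\<beta> - \<alpha> / 2) * c - (\<alpha> * \<beta> / 2 + \<gamma>\<^sup>2) * \<gamma> * b =
        - \<gamma> * (\<beta> * \<gamma> * c + (2 * \<beta>\<^sup>2 + \<gamma>\<^sup>2) * b)"
      "\<alpha> * ((\<beta>\<^sup>2 + \<gamma>\<^sup>2 / 2) * b + \<beta> * \<gamma> / 2 * c) =
        2 * \<beta> * (\<beta> * \<gamma> * c + (2 * \<beta>\<^sup>2 + \<gamma>\<^sup>2) * b)"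
      by (simp_all add: *(4) power2_eq_square algebra_simps)
    then show ?L
      unfolding collineation_iff_equations zero *(1) by simp
  next
    assume "a = 0" "b = 0" "c = 0"
    then show ?L
      unfolding collineation_iff_equations by simp
  qed
qed

end

section \<open>The collineation spaces for the individual parameters\<close>

theorem theorem3p15:
  fixes \<alpha> \<beta> \<gamma> :: real
    and gmult :: "'m::{t2_space, second_countable_topology} \<Rightarrow> 'm \<Rightarrow> 'm"
    and gunit :: 'm and ginv :: "'m \<Rightarrow> 'm"
    and \<A> :: "('m, real ^ 3) chart set"
    and g :: "'m metric" and J :: "'m endo" and D :: "'m connection"
    and e1 e2 e3 :: "'m field"
  assumes "\<gamma> \<noteq> 0"
    and "lie_group gmult gunit ginv \<A>" and "connected (UNIV :: 'm set)" and "unimodular gmult"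
    and "lorentzian_metric \<A> g" and "left_invariant_metric \<A> gmult g"
    and "product_structure \<A> J" and "left_invariant_endo \<A> gmult J"
    and "levi_civita_connection \<A> g D"
    and "{e1, e2, e3} \<subseteq> left_invariant_fields \<A> gmult"
    and "independent {e1, e2, e3}" and "span {e1, e2, e3} = left_invariant_fields \<A> gmult"
    and "pseudo_orthonormal g e1 e2 e3"
    and "lie_bracket e1 e2 = \<gamma> *\<^sub>R e2 - \<beta> *\<^sub>R e3"
    and "lie_bracket e1 e3 = - (\<beta> *\<^sub>R e2) - \<gamma> *\<^sub>R e3"
    and "lie_bracket e2 e3 = \<alpha> *\<^sub>R e1"
    and "endo_app J e1 = e1" and "endo_app J e2 = e2" and "endo_app J e3 = - e3"
  shows "let D1 = kobayashi_nomizu_connection D J;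
             V = ricci_collineations \<A> gmult g D1 e1 e2 e3 in
         (admits_ricci_collineations \<A> gmult g D1 e1 e2 e3 \<longleftrightarrow>
            (\<alpha> = 0 \<and> \<beta> = 0) \<or> (\<alpha> = 0 \<and> \<beta> \<noteq> 0) \<or> (\<alpha> \<noteq> 0 \<and> \<beta> \<noteq> 0 \<and> \<alpha> = 4 * \<beta>)) \<and>
         (\<alpha> = 0 \<and> \<beta> = 0 \<longrightarrow> V = span {e3}) \<and>
         (\<alpha> = 0 \<and> \<beta> \<noteq> 0 \<longrightarrow> V = span {e2 + (\<gamma> / \<beta>) *\<^sub>R e3}) \<and>
         (\<alpha> \<noteq> 0 \<and> \<beta> \<noteq> 0 \<and> \<alpha> = 4 * \<beta> \<longrightarrow>
            V = span {e2 - ((2 * \<beta>\<^sup>2 + \<gamma>\<^sup>2) / (\<beta> * \<gamma>)) *\<^sub>R e3})"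
proof -
  have "smooth_manifold \<A>"
    using lie_group.atlas[OF assms(2)] by (simp add: smooth_manifold_def)
  moreover have "e1 \<in> vector_fields \<A>" "e2 \<in> vector_fields \<A>" "e3 \<in> vector_fields \<A>"
    using assms(10) by (auto simp: left_invariant_fields_def)
  ultimately interpret g2_frame \<A> g e1 e2 e3 J D \<alpha> \<beta> \<gamma>
    using assms by (simp add: g2_frame_def lorentzian_frame_def lorentzian_frame_axioms_def
        g2_frame_axioms_def product_structure_def)
  define V where "V = ricci_collineations \<A> gmult g D1 e1 e2 e3"
  \<comment> \<open>Left-invariant fields are the span of the frame by hypothesis, so membership in
    \<open>V\<close> becomes the condition on the coefficients.\<close>
  have V: "frame_comb a b c \<in> V \<longleftrightarrow> a = 0 \<and> (\<alpha> = 0 \<and> \<beta> * c = \<gamma> * b \<or>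
      \<alpha> \<noteq> 0 \<and> \<beta> \<noteq> 0 \<and> \<alpha> = 4 * \<beta> \<and> c = - (2 * \<beta>\<^sup>2 + \<gamma>\<^sup>2) / (\<beta> * \<gamma>) * b \<or> b = 0 \<and> c = 0)" for a b c
    unfolding V_def ricci_collineations_def assms(12)[symmetric] span_frame
      collineation_iff[OF assms(1), symmetric] by blast
  have V_comb: "\<exists>a b c. \<xi> = frame_comb a b c" if "\<xi> \<in> V" for \<xi>
    using that unfolding V_def ricci_collineations_def assms(12)[symmetric] span_frame by blast
  have case1: "V = span {e3}" if "\<alpha> = 0" "\<beta> = 0"
  proof -
    have "V = span {frame_comb 0 0 1}"
    proof (intro equalityI subsetI)
      fix \<xi> assume "\<xi> \<in> V"
      moreover from V_comb[OF this] obtain a b c where "\<xi> = frame_comb a b c" by blast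
      ultimately show "\<xi> \<in> span {frame_comb 0 0 1}"
        using that assms(1) by (auto simp: V span_singleton_frame_comb)
    qed (use that in \<open>auto simp: V span_singleton_frame_comb\<close>)
    then show ?thesis
      unfolding frame_eq_comb[symmetric] .
  qed
  have case2: "V = span {e2 + (\<gamma> / \<beta>) *\<^sub>R e3}" if "\<alpha> = 0" "\<beta> \<noteq> 0"
  proof -
    have "V = span {frame_comb 0 1 (\<gamma> / \<beta>)}"
    proof (intro equalityI subsetI)
      fix \<xi> assume \<xi>: "\<xi> \<in> V"
      from V_comb[OF this] obtain a b c where comb: "\<xi> = frame_comb a b c" by blast
      have "a = 0" "\<beta> * c = \<gamma> * b"
        using \<xi> that unfolding comb V by auto
      \<comment> \<open>Division by \<beta> gives \<open>c = b * (\<gamma> / \<beta>)\<close>, so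
        \<xi> is \<open>b\<close> times the spanning field.\<close>
      then have "\<xi> = frame_comb (b * 0) (b * 1) (b * (\<gamma> / \<beta>))"
        using that by (simp add: comb frame_comb_eq_iff field_simps)
      then show "\<xi> \<in> span {frame_comb 0 1 (\<gamma> / \<beta>)}"
        unfolding span_singleton_frame_comb by blast
    qed (use that in \<open>auto simp: V span_singleton_frame_comb\<close>)
    then show ?thesis
      by (simp add: frame_comb_def)
  qed
  have case3: "V = span {e2 - ((2 * \<beta>\<^sup>2 + \<gamma>\<^sup>2) / (\<beta> * \<gamma>)) *\<^sub>R e3}"
    if "\<alpha> \<noteq> 0" "\<beta> \<noteq> 0" "\<alpha> = 4 * \<beta>"
  proof -
    have "V = span {frame_comb 0 1 (- (2 * \<beta>\<^sup>2 + \<gamma>\<^sup>2) / (\<beta> * \<gamma>))}" (is "_ = span {frame_comb 0 1 ?r}")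
    proof (intro equalityI subsetI)
      fix \<xi> assume \<xi>: "\<xi> \<in> V"
      from V_comb[OF this] obtain a b c where comb: "\<xi> = frame_comb a b c" by blast
      have "a = 0" "c = ?r * b"
        using \<xi> that unfolding comb V by auto
      then have "\<xi> = frame_comb (b * 0) (b * 1) (b * ?r)"
        by (simp add: comb frame_comb_eq_iff mult.commute)
      then show "\<xi> \<in> span {frame_comb 0 1 ?r}"
        unfolding span_singleton_frame_comb by blast
    next
      fix \<xi> assume "\<xi> \<in> span {frame_comb 0 1 ?r}"
      then obtain k where "\<xi> = frame_comb (k * 0) (k * 1) (k * ?r)"
        unfolding span_singleton_frame_comb by blast
      then show "\<xi> \<in> V"
        using that by (simp only: V) simp
    qed
    moreover have "?r = - ((2 * \<beta>\<^sup>2 + \<gamma>\<^sup>2) / (\<beta> * \<gamma>))"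
      by (rule minus_divide_left[symmetric])
    ultimately show ?thesis
      by (simp only: frame_comb_def scaleR_minus_left scaleR_zero_left scaleR_one add_0_left
          diff_conv_add_uminus)
  qed
  have "admits_ricci_collineations \<A> gmult g D1 e1 e2 e3 \<longleftrightarrow>
      (\<alpha> = 0 \<and> \<beta> = 0) \<or> (\<alpha> = 0 \<and> \<beta> \<noteq> 0) \<or> (\<alpha> \<noteq> 0 \<and> \<beta> \<noteq> 0 \<and> \<alpha> = 4 * \<beta>)" (is "_ \<longleftrightarrow> ?C")
  proof
    assume "admits_ricci_collineations \<A> gmult g D1 e1 e2 e3"
    then obtain \<xi> where \<xi>: "\<xi> \<in> V" "\<xi> \<noteq> 0"
      unfolding admits_ricci_collineations_def V_def by blast
    from V_comb[OF \<xi>(1)] obtain a b c where "\<xi> = frame_comb a b c" by blast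
    \<comment> \<open>A nonzero field rules out the alternative \<open>b = 0 \<and> c = 0\<close>,
      and the other two imply the listed parameter cases.\<close>
    with \<xi> show ?C
      by (auto simp: V frame_comb_eq_zero_iff)
  next
    assume ?C
    then consider "\<alpha> = 0" | "\<alpha> \<noteq> 0" "\<beta> \<noteq> 0" "\<alpha> = 4 * \<beta>" by blast
    then have "\<exists>b c. frame_comb 0 b c \<in> V \<and> frame_comb 0 b c \<noteq> 0"
    proof cases
      case 1
      \<comment> \<open>The coefficients \<open>b = \<beta>\<close> and \<open>c = \<gamma>\<close>
        solve \<open>\<beta> * c = \<gamma> * b\<close> for every \<beta>, and \<gamma> \<noteq> 0
        makes the field nonzero. One witness thus serves both cases with \<alpha> = 0.\<close>
      then have "frame_comb 0 \<beta> \<gamma> \<in> V \<and> frame_comb 0 \<beta> \<gamma> \<noteq> 0"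
        using assms(1) by (simp add: V frame_comb_eq_zero_iff)
      then show ?thesis by blast
    next
      case 2
      let ?c = "- (2 * \<beta>\<^sup>2 + \<gamma>\<^sup>2) / (\<beta> * \<gamma>)"
      have "frame_comb 0 1 ?c \<in> V \<and> frame_comb 0 1 ?c \<noteq> 0"
        using 2 by (simp add: V frame_comb_eq_zero_iff)
      then show ?thesis by blast
    qed
    then show "admits_ricci_collineations \<A> gmult g D1 e1 e2 e3"
      unfolding admits_ricci_collineations_def V_def by blast
  qed
  then show ?thesis
    unfolding Let_def V_def[symmetric] using case1 case2 case3 by blast
qed

end
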